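(* Let $d\ge1$, $p\in(1,2]$ and $m\in(-\infty,\infty)$. Let $L=(1+|x|)^m\Delta$ in $R^d$, $\beta=0$, and $\alpha(x)=(1+|x|)^{m-2}$. Then the compact support property holds for the measure-valued diffusion $X(t)$ on $R^d$ corresponding to the equation $u_t=Lu+\beta u-\alpha u^p$. However, if $m>2$ and $d\ge3$, the diffusion process $Y(t)$ corresponding to $L$ explodes and $\sup_{x\in R^d}E_x\tau_\infty<\infty$.
   Context: Underlying diffusion: $Y(t)$ is the diffusion process corresponding to the generalized martingale problem for $L$ on $R^d$ (run up to its possibly finite lifetime), with probabilities $\mathcal P_x$ and expectations $E_x$ when started from $x$. Its lifetime is $\tau_\infty=\lim_{n\to\infty}\tau_n$, where $\tau_n=\inf\{t\ge0:|Y(t)|\ge n\}$. $Y(t)$ is non-explosive if $\mathcal P_x(\tau_\infty<\infty)=0$ for some, or equivalently all, $x\in R^d$; otherwise it is explosive (it "explodes"). Measure-valued diffusion: $X(t)=X(t,\cdot)$ is the (càdlàg) Markov process with values in the finite measures on $R^d$, with law $P_\mu$ when $X(0)=\mu$, defined uniquely by the log-Laplace equation $$E_\mu\big(\exp(-\langle f,X(t)\rangle)\big)=\exp(-\langle u_f(\cdot,t),\mu\rangle),$$ for all nonnegative, continuous, compactly supported $f$ on $R^d$ and all finite measures $\mu$, where $u_f$ is the minimal positive (classical) solution of $u_t=Lu+\beta u-\alpha u^p$ in $R^d\times(0,\infty)$, $u(x,0)=f(x)$ in $R^d$, $u\ge 0$ in $R^d\times[0,\infty)$. Compact support property: for a compactly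 supported finite measure $\mu$, the process under $P_\mu$ has the compact support property if $P_\mu\big(\bigcup_{0\le s\le t}\mathrm{supp}\,X(s)\text{ is bounded}\big)=1$ for all $t\ge0$. This property holds for one nonzero compactly supported initial measure $\mu$ if and only if it holds for all of them; "the compact support property holds for $X(t)$" means that it holds for one, equivalently all, such $\mu$. *)

theory Defs
  imports "HOL-Probability.Probability"
begin

section \<open>Differential operators and classical solutions\<close>

definition partial :: "'a::euclidean_space \<Rightarrow> ('a \<Rightarrow> real) \<Rightarrow> 'a \<Rightarrow> real" where
  "partial b f x = frechet_derivative f (at x) b"

definition C1_fun :: "('a::euclidean_space \<Rightarrow> real) \<Rightarrow> bool" where
  "C1_fun f \<longleftrightarrow> (\<forall>x. f differentiable (at x)) \<and> (\<forall>b\<in>Basis. continuous_on UNIV (partial b f))"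

definition C2_fun :: "('a::euclidean_space \<Rightarrow> real) \<Rightarrow> bool" where
  "C2_fun f \<longleftrightarrow> C1_fun f \<and> (\<forall>b\<in>Basis. C1_fun (partial b f))"

definition laplacian :: "('a::euclidean_space \<Rightarrow> real) \<Rightarrow> 'a \<Rightarrow> real" where
  "laplacian f x = (\<Sum>b\<in>Basis. partial b (partial b f) x)"

definition weighted_laplacian :: "real \<Rightarrow> ('a::euclidean_space \<Rightarrow> real) \<Rightarrow> 'a \<Rightarrow> real" where
  "weighted_laplacian m f x = (1 + norm x) powr m * laplacian f x"

text \<open>Nonnegative solutions of class \<open>C\<^sup>2\<close> in space and \<open>C\<^sup>1\<close> in time for \<open>t > 0\<close>, continuous up to
  \<open>t = 0\<close>, of \<open>u\<^sub>t = L u + \<beta> u - \<alpha> u\<^sup>p\<close> with initial value \<open>f\<close>.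
  Values \<open>u x t\<close> with \<open>t < 0\<close> are irrelevant.\<close>

definition classical_solution ::
  "(('a::euclidean_space \<Rightarrow> real) \<Rightarrow> 'a \<Rightarrow> real) \<Rightarrow> ('a \<Rightarrow> real) \<Rightarrow> ('a \<Rightarrow> real) \<Rightarrow> real \<Rightarrow>
    ('a \<Rightarrow> real) \<Rightarrow> ('a \<Rightarrow> real \<Rightarrow> real) \<Rightarrow> bool" where
  "classical_solution L \<beta> \<alpha> p f u \<longleftrightarrow>
     continuous_on (UNIV \<times> {0..}) (\<lambda>(x, t). u x t) \<and>
     (\<forall>t>0. C2_fun (\<lambda>x. u x t)) \<and>
     (\<forall>b\<in>Basis. continuous_on (UNIV \<times> {0<..}) (\<lambda>(x, t). partial b (\<lambda>y. u y t) x)) \<and>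
     (\<forall>b\<in>Basis. \<forall>c\<in>Basis.
        continuous_on (UNIV \<times> {0<..}) (\<lambda>(x, t). partial c (partial b (\<lambda>y. u y t)) x)) \<and>
     (\<forall>x. \<forall>t>0. u x differentiable (at t)) \<and>
     continuous_on (UNIV \<times> {0<..}) (\<lambda>(x, t). deriv (u x) t) \<and>
     (\<forall>x. \<forall>t>0. deriv (u x) t = L (\<lambda>y. u y t) x + \<beta> x * u x t - \<alpha> x * u x t powr p) \<and>
     (\<forall>x. u x 0 = f x) \<and>
     (\<forall>x. \<forall>t\<ge>0. 0 \<le> u x t)"

definition minimal_solution ::
  "(('a::euclidean_space \<Rightarrow> real) \<Rightarrow> 'a \<Rightarrow> real) \<Rightarrow> ('a \<Rightarrow> real) \<Rightarrow> ('a \<Rightarrow> real) \<Rightarrow> real \<Rightarrow>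
    ('a \<Rightarrow> real) \<Rightarrow> ('a \<Rightarrow> real \<Rightarrow> real) \<Rightarrow> bool" where
  "minimal_solution L \<beta> \<alpha> p f u \<longleftrightarrow>
     classical_solution L \<beta> \<alpha> p f u \<and>
     (\<forall>v. classical_solution L \<beta> \<alpha> p f v \<longrightarrow> (\<forall>x. \<forall>t\<ge>0. u x t \<le> v x t))"


section \<open>Filtrations generated by processes\<close>

definition natural_filtration ::
  "'w measure \<Rightarrow> 's measure \<Rightarrow> (real \<Rightarrow> 'w \<Rightarrow> 's) \<Rightarrow> real \<Rightarrow> 'w measure" where
  "natural_filtration \<Omega> S X t = (SUP r\<in>{0..t}. vimage_algebra (space \<Omega>) (X r) S)"

definition martingale :: "'w measure \<Rightarrow> (real \<Rightarrow> 'w measure) \<Rightarrow> (real \<Rightarrow> 'w \<Rightarrow> real) \<Rightarrow> bool" where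
  "martingale P F M \<longleftrightarrow>
     (\<forall>t\<ge>0. M t \<in> borel_measurable (F t) \<and> integrable P (M t)) \<and>
     (\<forall>s t. 0 \<le> s \<and> s \<le> t \<longrightarrow> (AE \<omega> in P. real_cond_exp P (F s) (M t) \<omega> = M s \<omega>))"


section \<open>The diffusion process of the generalized martingale problem\<close>

text \<open>The state space is the one-point compactification of \<open>'a\<close>; the added point \<open>None\<close> is the
  cemetery state.\<close>

definition compactified_borel :: "'a::euclidean_space option measure" where
  "compactified_borel = sigma UNIV {U. openin (Alexandroff_compactification euclidean) U}"

text \<open>The cemetery state counts as having infinite norm; times take the value \<open>\<infinity>\<close> when the
  infimum is over the empty set.\<close>

definition exit_time :: "(real \<Rightarrow> 'w \<Rightarrow> 'a::euclidean_space option) \<Rightarrow> nat \<Rightarrow> 'w \<Rightarrow> ennreal" where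
  "exit_time Y n \<omega> =
     Inf {ennreal t | t. 0 \<le> t \<and> (case Y t \<omega> of None \<Rightarrow> True | Some y \<Rightarrow> real n \<le> norm y)}"

definition lifetime :: "(real \<Rightarrow> 'w \<Rightarrow> 'a::euclidean_space option) \<Rightarrow> 'w \<Rightarrow> ennreal" where
  "lifetime Y \<omega> = lim (\<lambda>n. exit_time Y n \<omega>)"

text \<open>The process \<open>f (Y (t \<and> \<tau>\<^sub>n)) - \<integral>\<^sub>0\<^bsup>t \<and> \<tau>\<^sub>n\<^esup> (L f) (Y s) ds\<close>. If \<open>Y\<close> starts in the state space
  \<open>'a\<close>, it does not reach \<open>None\<close> up to time \<open>t \<and> \<tau>\<^sub>n\<close>, so \<open>the\<close> is harmless here.\<close>

definition dynkin_process ::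
  "(('a::euclidean_space \<Rightarrow> real) \<Rightarrow> 'a \<Rightarrow> real) \<Rightarrow> (real \<Rightarrow> 'w \<Rightarrow> 'a option) \<Rightarrow> nat \<Rightarrow>
    ('a \<Rightarrow> real) \<Rightarrow> real \<Rightarrow> 'w \<Rightarrow> real" where
  "dynkin_process L Y n f t \<omega> =
     (let r = enn2real (min (ennreal t) (exit_time Y n \<omega>)) in
        f (the (Y r \<omega>)) - integral {0..r} (\<lambda>s. L f (the (Y s \<omega>))))"

locale diffusion_process =
  fixes L :: "('a::euclidean_space \<Rightarrow> real) \<Rightarrow> 'a \<Rightarrow> real"
    and \<Omega> :: "'w measure"
    and P :: "'a \<Rightarrow> 'w measure"
    and Y :: "real \<Rightarrow> 'w \<Rightarrow> 'a option"
  assumes prob_space_P: "\<And>x. prob_space (P x)"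
    and sets_P: "\<And>x. sets (P x) = sets \<Omega>"
    and measurable_Y: "\<And>t. 0 \<le> t \<Longrightarrow> Y t \<in> measurable \<Omega> compactified_borel"
    and continuous_paths: "\<And>\<omega>. \<omega> \<in> space \<Omega> \<Longrightarrow>
      continuous_map (top_of_set {0..}) (Alexandroff_compactification euclidean) (\<lambda>t. Y t \<omega>)"
    and absorbed: "\<And>\<omega> s t. \<lbrakk>\<omega> \<in> space \<Omega>; 0 \<le> s; s \<le> t; Y s \<omega> = None\<rbrakk> \<Longrightarrow> Y t \<omega> = None"
    and starts_at: "\<And>x. AE \<omega> in P x. Y 0 \<omega> = Some x"
    and martingale_problem: "\<And>x n f. C2_fun f \<Longrightarrow>
      martingale (P x) (natural_filtration \<Omega> compactified_borel Y) (dynkin_process L Y n f)"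

definition nonexplosive ::
  "('a::euclidean_space \<Rightarrow> 'w measure) \<Rightarrow> (real \<Rightarrow> 'w \<Rightarrow> 'a option) \<Rightarrow> bool" where
  "nonexplosive P Y \<longleftrightarrow> (\<exists>x. AE \<omega> in P x. \<not> lifetime Y \<omega> < \<infinity>)"

abbreviation explosive ::
  "('a::euclidean_space \<Rightarrow> 'w measure) \<Rightarrow> (real \<Rightarrow> 'w \<Rightarrow> 'a option) \<Rightarrow> bool" where
  "explosive P Y \<equiv> \<not> nonexplosive P Y"


section \<open>The measure-valued diffusion\<close>

definition finite_measures :: "'a::topological_space measure set" where
  "finite_measures = {\<mu>. finite_measure \<mu> \<and> sets \<mu> = sets borel}"

text \<open>The analogue of \<^const>\<open>subprob_algebra\<close> for finite measures.\<close>

definition finite_measure_algebra :: "'a::topological_space measure measure" where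
  "finite_measure_algebra =
     (SUP A\<in>sets borel. vimage_algebra finite_measures (\<lambda>\<mu>. emeasure \<mu> A) borel)"

definition weakly_tends ::
  "('t \<Rightarrow> 'a::topological_space measure) \<Rightarrow> 'a measure \<Rightarrow> 't filter \<Rightarrow> bool" where
  "weakly_tends N \<nu> F \<longleftrightarrow>
     (\<forall>g :: 'a \<Rightarrow> real. continuous_on UNIV g \<and> bounded (range g) \<longrightarrow>
        ((\<lambda>s. \<integral>x. g x \<partial>N s) \<longlongrightarrow> (\<integral>x. g x \<partial>\<nu>)) F)"

definition measure_support :: "'a::topological_space measure \<Rightarrow> 'a set" where
  "measure_support \<mu> = {x. \<forall>U. open U \<and> x \<in> U \<longrightarrow> 0 < emeasure \<mu> U}"

text \<open>A time-homogeneous Markov process with values in the finite measures and weakly cadlag paths,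
  related to the equation by its log-Laplace functional. For coefficients \<open>\<beta>\<close> bounded above
  and \<open>\<alpha> \<ge> 0\<close>, the minimal solution is bounded in space, so that its integral with respect to
  a finite measure is a genuine one.\<close>

locale measure_valued_diffusion =
  fixes L :: "('a::euclidean_space \<Rightarrow> real) \<Rightarrow> 'a \<Rightarrow> real"
    and \<beta> \<alpha> :: "'a \<Rightarrow> real"
    and p :: real
    and \<Omega> :: "'w measure"
    and P :: "'a measure \<Rightarrow> 'w measure"
    and X :: "real \<Rightarrow> 'w \<Rightarrow> 'a measure"
  assumes prob_space_P: "\<And>\<mu>. \<mu> \<in> finite_measures \<Longrightarrow> prob_space (P \<mu>)"
    and sets_P: "\<And>\<mu>. \<mu> \<in> finite_measures \<Longrightarrow> sets (P \<mu>) = sets \<Omega>"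
    and measurable_X: "\<And>t. 0 \<le> t \<Longrightarrow> X t \<in> measurable \<Omega> finite_measure_algebra"
    and right_continuous: "\<And>\<omega> t. \<lbrakk>\<omega> \<in> space \<Omega>; 0 \<le> t\<rbrakk> \<Longrightarrow>
      weakly_tends (\<lambda>s. X s \<omega>) (X t \<omega>) (at_right t)"
    and left_limits: "\<And>\<omega> t. \<lbrakk>\<omega> \<in> space \<Omega>; 0 < t\<rbrakk> \<Longrightarrow>
      \<exists>\<nu>\<in>finite_measures. weakly_tends (\<lambda>s. X s \<omega>) \<nu> (at_left t)"
    and starts_at: "\<And>\<mu>. \<mu> \<in> finite_measures \<Longrightarrow> AE \<omega> in P \<mu>. X 0 \<omega> = \<mu>"
    and kernel: "\<And>t. 0 \<le> t \<Longrightarrow>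
      (\<lambda>\<mu>. distr (P \<mu>) finite_measure_algebra (X t))
        \<in> measurable finite_measure_algebra (prob_algebra finite_measure_algebra)"
    and markov: "\<And>\<mu> s t B.
      \<lbrakk>\<mu> \<in> finite_measures; 0 \<le> s; 0 \<le> t; B \<in> sets finite_measure_algebra\<rbrakk> \<Longrightarrow>
      AE \<omega> in P \<mu>.
        real_cond_exp (P \<mu>) (natural_filtration \<Omega> finite_measure_algebra X s)
          (\<lambda>\<omega>'. indicator B (X (s + t) \<omega>')) \<omega>
        = measure (distr (P (X s \<omega>)) finite_measure_algebra (X t)) B"
    and log_laplace: "\<And>f.
      \<lbrakk>continuous_on UNIV f; \<And>x. 0 \<le> f x; compact (closure {x. f x \<noteq> 0})\<rbrakk> \<Longrightarrow>
      \<exists>u. minimal_solution L \<beta> \<alpha> p f u \<and>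
        (\<forall>\<mu>\<in>finite_measures. \<forall>t\<ge>0.
          (\<integral>\<omega>. exp (- (\<integral>x. f x \<partial>X t \<omega>)) \<partial>P \<mu>) = exp (- (\<integral>x. u x t \<partial>\<mu>)))"

definition compact_support_property ::
  "('a::euclidean_space measure \<Rightarrow> 'w measure) \<Rightarrow> (real \<Rightarrow> 'w \<Rightarrow> 'a measure) \<Rightarrow> bool" where
  "compact_support_property P X \<longleftrightarrow>
     (\<forall>\<mu>\<in>finite_measures. compact (measure_support \<mu>) \<longrightarrow>
        (\<forall>t\<ge>0. AE \<omega> in P \<mu>. bounded (\<Union>s\<in>{0..t}. measure_support (X s \<omega>))))"

end

theory Submission
  imports Defs "HOL-Real_Asymp.Real_Asymp"
begin

text \<open>
  The compact support property rests on a barrier for the equation, and explosion rests on a bounded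
  Lyapunov function for the diffusion. Both are explicit radial functions.

  \<^bold>\<open>Compact support.\<close> Let \<open>V\<close> be a stationary supersolution on a ball, \<open>L V \<le> \<alpha> * V powr p\<close>, that
  blows up at the boundary sphere, and let \<open>U\<close> be \<open>V\<close> inside the ball and \<open>\<infinity>\<close> elsewhere. By the
  maximum principle (\<open>comparison_with_blowup_supersolution\<close>) every classical solution that starts below
  \<open>U\<close> stays below \<open>U\<close>. Through the log-Laplace formula this becomes the inequality
  \<open>E\<^sub>\<mu> (exp (- \<langle>U, X t\<rangle>)) \<ge> exp (- \<langle>U, \<mu>\<rangle>)\<close> of \<open>barrier_functional_submean\<close>: the process
  \<open>exp (- \<langle>U, X t\<rangle>)\<close> is a submartingale with values in \<open>[0, 1]\<close> that vanishes as soon as \<open>X t\<close>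
  charges the outside of the ball. By the maximal inequality (\<open>barrier_functional_survival\<close>), no mass
  is found outside the ball at any rational time, with probability at least \<open>exp (- \<langle>U, \<mu>\<rangle>)\<close>;
  right-continuity extends this to all times. It remains to find such \<open>V\<close> on larger and larger balls
  that tend to \<open>0\<close> uniformly on compact sets. For \<open>L = (1 + |x|) powr m * \<Delta>\<close> and
  \<open>\<alpha> x = (1 + |x|) powr (m - 2)\<close> the inequality reads \<open>(1 + |x|)\<^sup>2 * \<Delta>V \<le> V powr p\<close>, whatever \<open>m\<close> is,
  and \<open>V x = A * (S - ln (1 + |x|\<^sup>2)) powr (- \<gamma>)\<close> with \<open>\<gamma> = 2 / (p - 1)\<close> solves it for a constant \<open>A\<close> of
  order \<open>S powr (\<gamma> / 2)\<close> (\<open>barrier_log_barrier\<close>). At a fixed point \<open>V\<close> is then of order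
  \<open>S powr (- \<gamma> / 2)\<close>, which tends to \<open>0\<close> as \<open>S \<rightarrow> \<infinity>\<close> (\<open>log_barrier_small\<close>).

  \<^bold>\<open>Explosion.\<close> For \<open>m > 2\<close> and \<open>d \<ge> 3\<close> the function \<open>f x = (1 + |x|\<^sup>2) powr (- e)\<close> with small \<open>e > 0\<close>
  satisfies \<open>0 \<le> f \<le> 1\<close> and \<open>L f \<le> - e\<close> (\<open>ex_bounded_lyapunov\<close>). Stopping at the exit time of a
  ball, Dynkin's formula gives \<open>e * E\<^sub>x (t \<and> \<tau>\<^sub>n) \<le> f x \<le> 1\<close>, and letting \<open>t\<close> and \<open>n\<close> tend to
  infinity bounds the expected lifetime by \<open>1 / e\<close>, uniformly in the starting point.
\<close>

section \<open>Natural filtrations\<close>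

lemma measurable_natural_filtration:
  assumes X: "\<And>r. 0 \<le> r \<Longrightarrow> X r \<in> measurable \<Omega> S" and "0 \<le> r" "r \<le> t"
  shows "X r \<in> measurable (natural_filtration \<Omega> S X t) S"
  unfolding natural_filtration_def
proof (rule measurable_SUP1[of r])
  show "X r \<in> measurable (vimage_algebra (space \<Omega>) (X r) S) S"
    using X[OF \<open>0 \<le> r\<close>] by (intro measurable_vimage_algebra1) (auto dest: measurable_space)
qed (use assms in auto)

lemma natural_filtration_subalgebra:
  assumes X: "\<And>r. 0 \<le> r \<Longrightarrow> X r \<in> measurable \<Omega> S" and P: "sets P = sets \<Omega>" and "0 \<le> t"
  shows "subalgebra P (natural_filtration \<Omega> S X t)"
proof -
  have sp: "space P = space \<Omega>"
    using P by (rule sets_eq_imp_space_eq)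
  have ne: "{0..t} \<noteq> {}"
    using \<open>0 \<le> t\<close> by simp
  have "space (natural_filtration \<Omega> S X t) = space \<Omega>"
    unfolding natural_filtration_def space_Sup_eq_UN using ne by auto
  moreover have "sets (natural_filtration \<Omega> S X t) \<subseteq> sets \<Omega>"
    unfolding natural_filtration_def
  proof (rule sets_Sup_in_sets)
    fix N assume "N \<in> (\<lambda>r. vimage_algebra (space \<Omega>) (X r) S) ` {0..t}"
    then obtain r where "0 \<le> r" and N: "N = vimage_algebra (space \<Omega>) (X r) S"
      by auto
    show "sets N \<subseteq> sets \<Omega>"
      unfolding N using X[OF \<open>0 \<le> r\<close>] by (intro sets_image_in_sets) auto
  qed (use ne in auto)
  ultimately show ?thesis
    by (simp add: subalgebra_def sp P)
qed

section \<open>Measurable functionals of finite measures\<close>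

lemma space_finite_measure_algebra: "space finite_measure_algebra = finite_measures"
  unfolding finite_measure_algebra_def space_Sup_eq_UN by auto

lemma measurable_emeasure_finite_measures:
  assumes "A \<in> sets (borel :: 'a::topological_space measure)"
  shows "(\<lambda>\<mu>. emeasure \<mu> A) \<in> borel_measurable finite_measure_algebra"
  unfolding finite_measure_algebra_def
  by (rule measurable_SUP1[OF assms]) (auto intro: measurable_vimage_algebra1)

text \<open>The \<open>\<sigma>\<close>-algebra on the finite measures is generated by evaluations on Borel sets, so the claim
  is immediate for indicators and passes to all nonnegative \<open>g\<close> by monotone classes.\<close>

lemma measurable_nn_integral_finite_measures:
  assumes "g \<in> borel_measurable (borel :: 'a::topological_space measure)"
  shows "(\<lambda>\<mu>. \<integral>\<^sup>+ x. g x \<partial>\<mu>) \<in> borel_measurable finite_measure_algebra"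
  using assms
proof (induction rule: borel_measurable_induct)
  case (cong f g)
  then show ?case by (simp add: fun_eq_iff)
next
  case (set A)
  have "(\<lambda>\<mu>. \<integral>\<^sup>+ x. indicator A x \<partial>\<mu>) \<in> borel_measurable finite_measure_algebra \<longleftrightarrow>
      (\<lambda>\<mu>. emeasure \<mu> A) \<in> borel_measurable finite_measure_algebra"
    using set by (intro measurable_cong nn_integral_indicator)
      (auto simp: space_finite_measure_algebra finite_measures_def)
  then show ?case
    using measurable_emeasure_finite_measures[OF set] by simp
next
  case (mult u c)
  have "(\<lambda>\<mu>. \<integral>\<^sup>+ x. c * u x \<partial>\<mu>) \<in> borel_measurable finite_measure_algebra \<longleftrightarrow>
      (\<lambda>\<mu>. c * \<integral>\<^sup>+ x. u x \<partial>\<mu>) \<in> borel_measurable finite_measure_algebra"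
    using mult by (intro measurable_cong nn_integral_cmult)
      (auto simp: space_finite_measure_algebra finite_measures_def cong: measurable_cong_sets)
  then show ?case
    using mult by simp
next
  case (add u v)
  have "(\<lambda>\<mu>. \<integral>\<^sup>+ x. v x + u x \<partial>\<mu>) \<in> borel_measurable finite_measure_algebra \<longleftrightarrow>
      (\<lambda>\<mu>. (\<integral>\<^sup>+ x. v x \<partial>\<mu>) + (\<integral>\<^sup>+ x. u x \<partial>\<mu>)) \<in> borel_measurable finite_measure_algebra"
    using add by (intro measurable_cong nn_integral_add)
      (auto simp: space_finite_measure_algebra finite_measures_def cong: measurable_cong_sets)
  then show ?case
    using add by simp
next
  case (seq F)
  have "(\<lambda>\<mu>. \<integral>\<^sup>+ x. (SUP i. F i) x \<partial>\<mu>) \<in> borel_measurable finite_measure_algebra \<longleftrightarrow>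
      (\<lambda>\<mu>. SUP i. \<integral>\<^sup>+ x. F i x \<partial>\<mu>) \<in> borel_measurable finite_measure_algebra"
    unfolding SUP_apply using seq 
    by (intro measurable_cong nn_integral_monotone_convergence_SUP)
      (auto simp: space_finite_measure_algebra finite_measures_def cong: measurable_cong_sets)
  then show ?case
    using seq by simp
qed

text \<open>The convention \<open>exp (- \<infinity>) = 0\<close> makes the statement \<open>exp_neg (\<integral>\<^sup>+ x. U x \<partial>\<nu>) \<noteq> 0\<close> say that
  \<open>U\<close> has a finite integral, and hence that \<open>\<nu>\<close> does not charge the set where \<open>U\<close> is infinite.\<close>

definition exp_neg :: "ennreal \<Rightarrow> real" where
  "exp_neg z = (if z = \<infinity> then 0 else exp (- enn2real z))"

lemma exp_neg_bounds: "0 \<le> exp_neg z" "exp_neg z \<le> 1"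
  by (auto simp: exp_neg_def)

lemma measurable_exp_neg [measurable]: "exp_neg \<in> borel_measurable borel"
  unfolding exp_neg_def by measurable

text \<open>The Bochner integral of a nonnegative function is at most its nonnegative integral: they agree for
  integrable functions, and otherwise the Bochner integral is \<open>0\<close> by default.\<close>

lemma exp_neg_le_exp_integral:
  assumes "\<And>x. 0 \<le> g x" "\<And>x. ennreal (g x) \<le> U x"
  shows "exp_neg (\<integral>\<^sup>+ x. U x \<partial>\<nu>) \<le> exp (- (\<integral>x. g x \<partial>\<nu>))"
proof (cases "(\<integral>\<^sup>+ x. U x \<partial>\<nu>) = \<infinity>")
  case False
  have le: "(\<integral>\<^sup>+ x. ennreal (g x) \<partial>\<nu>) \<le> (\<integral>\<^sup>+ x. U x \<partial>\<nu>)"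
    using assms by (intro nn_integral_mono)
  have "(\<integral>x. g x \<partial>\<nu>) \<le> enn2real (\<integral>\<^sup>+ x. U x \<partial>\<nu>)"
  proof (cases "integrable \<nu> g")
    case True
    then show ?thesis
      using assms le False by (subst integral_eq_nn_integral) (auto intro!: enn2real_mono simp: top.not_eq_extremum)
  qed (simp add: not_integrable_integral_eq)
  then show ?thesis
    using False by (simp add: exp_neg_def)
qed (simp add: exp_neg_def)

lemma exp_integral_tendsto_exp_neg:
  fixes f :: "nat \<Rightarrow> 'a \<Rightarrow> real"
  assumes f: "\<And>k x. 0 \<le> f k x" "\<And>x. incseq (\<lambda>k. f k x)" "\<And>k. integrable \<nu> (f k)"
    and U: "\<And>x. U x = (SUP k. ennreal (f k x))"
  shows "(\<lambda>k. exp (- (\<integral>x. f k x \<partial>\<nu>))) \<longlonglongrightarrow> exp_neg (\<integral>\<^sup>+ x. U x \<partial>\<nu>)"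
proof -
  define a where "a k = (\<integral>x. f k x \<partial>\<nu>)" for k
  have a: "ennreal (a k) = (\<integral>\<^sup>+ x. ennreal (f k x) \<partial>\<nu>)" for k
    unfolding a_def using f by (subst nn_integral_eq_integral) auto
  have a0: "0 \<le> a k" for k
    unfolding a_def using f by simp
  have inc: "incseq (\<lambda>k x. ennreal (f k x))"
    using f(2) by (auto simp: incseq_def le_fun_def intro!: ennreal_leI)
  have "(\<integral>\<^sup>+ x. U x \<partial>\<nu>) = (SUP k. ennreal (a k))"
    unfolding U a using f by (intro nn_integral_monotone_convergence_SUP inc) (auto dest: borel_measurable_integrable)
  moreover have "incseq (\<lambda>k. ennreal (a k))"
    unfolding a using inc by (auto simp: incseq_def le_fun_def intro!: nn_integral_mono)
  ultimately have lim: "(\<lambda>k. ennreal (a k)) \<longlonglongrightarrow> (\<integral>\<^sup>+ x. U x \<partial>\<nu>)"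
    by (simp add: LIMSEQ_SUP)
  show ?thesis
  proof (cases "(\<integral>\<^sup>+ x. U x \<partial>\<nu>) = \<infinity>")
    case True
    then have "filterlim a at_top sequentially"
      using lim by (simp add: ennreal_tendsto_top_eq_at_top)
    then have "filterlim (\<lambda>k. - a k) at_bot sequentially"
      by (simp add: filterlim_uminus_at_top)
    then have "(\<lambda>k. exp (- a k)) \<longlonglongrightarrow> 0"
      by (rule filterlim_compose[OF exp_at_bot])
    then show ?thesis
      using True by (simp add: exp_neg_def a_def)
  next
    case False
    then have "(\<lambda>k. ennreal (a k)) \<longlonglongrightarrow> ennreal (enn2real (\<integral>\<^sup>+ x. U x \<partial>\<nu>))"
      using lim by (simp add: top.not_eq_extremum)
    then have "a \<longlonglongrightarrow> enn2real (\<integral>\<^sup>+ x. U x \<partial>\<nu>)"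
      by (rule tendsto_ennrealD) (use a0 in auto)
    then have "(\<lambda>k. exp (- a k)) \<longlonglongrightarrow> exp (- enn2real (\<integral>\<^sup>+ x. U x \<partial>\<nu>))"
      by (intro tendsto_intros)
    then show ?thesis
      using False by (simp add: exp_neg_def a_def)
  qed
qed

section \<open>Barriers and the Markov property\<close>

text \<open>A supersolution that dominates every classical solution starting below it. It may take the value
  \<open>\<infinity>\<close>, in which case it controls solutions only on the set where it is finite, irrespective of
  their size elsewhere.\<close>

definition barrier ::
  "(('a::euclidean_space \<Rightarrow> real) \<Rightarrow> 'a \<Rightarrow> real) \<Rightarrow> ('a \<Rightarrow> real) \<Rightarrow> ('a \<Rightarrow> real) \<Rightarrow> real \<Rightarrow>
    ('a \<Rightarrow> ennreal) \<Rightarrow> bool" where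
  "barrier L \<beta> \<alpha> p U \<longleftrightarrow>
     (\<forall>f u. classical_solution L \<beta> \<alpha> p f u \<and> (\<forall>x. ennreal (f x) \<le> U x) \<longrightarrow>
       (\<forall>x. \<forall>t\<ge>0. ennreal (u x t) \<le> U x))"

text \<open>This is lower semicontinuity, in the form in which it combines with the log-Laplace formula, which
  speaks about continuous functions of compact support.\<close>

definition approximable_from_below :: "('a::euclidean_space \<Rightarrow> ennreal) \<Rightarrow> bool" where
  "approximable_from_below U \<longleftrightarrow>
     (\<exists>f :: nat \<Rightarrow> 'a \<Rightarrow> real. (\<forall>k. continuous_on UNIV (f k) \<and> (\<forall>x. 0 \<le> f k x) \<and>
          compact (closure {x. f k x \<noteq> 0})) \<and>
        (\<forall>x. incseq (\<lambda>k. f k x)) \<and> (\<forall>x. U x = (SUP k. ennreal (f k x))))"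

lemma integrable_compact_support:
  fixes f :: "'a::euclidean_space \<Rightarrow> real"
  assumes "continuous_on UNIV f" "compact (closure {x. f x \<noteq> 0})" "\<nu> \<in> finite_measures"
  shows "integrable \<nu> f"
proof -
  interpret finite_measure \<nu> using assms(3) by (simp add: finite_measures_def)
  have "bounded (f ` closure {x. f x \<noteq> 0})"
    using assms by (intro compact_imp_bounded compact_continuous_image) (auto intro: continuous_on_subset)
  then obtain B where B: "\<And>x. x \<in> closure {x. f x \<noteq> 0} \<Longrightarrow> norm (f x) \<le> B"
    by (auto simp: bounded_iff)
  have "norm (f x) \<le> max B 0" for x
  proof (cases "f x = 0")
    case False
    then have "x \<in> closure {x. f x \<noteq> 0}" using closure_subset[of "{x. f x \<noteq> 0}"] by auto
    then show ?thesis using B[of x] by simp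
  qed simp
  moreover have "f \<in> borel_measurable \<nu>"
    using borel_measurable_continuous_onI[OF assms(1)] assms(3)
    by (simp add: finite_measures_def cong: measurable_cong_sets)
  ultimately show ?thesis
    by (intro integrable_const_bound[where B = "max B 0"]) auto
qed

lemma measurable_approximable:
  assumes "approximable_from_below U"
  shows "U \<in> borel_measurable borel"
proof -
  obtain f :: "nat \<Rightarrow> _" where "\<And>k. continuous_on UNIV (f k)" "\<And>x. U x = (SUP k. ennreal (f k x))"
    using assms by (auto simp: approximable_from_below_def)
  then have "f k \<in> borel_measurable borel" "U = (\<lambda>x. SUP k. ennreal (f k x))" for k
    by (auto intro: borel_measurable_continuous_onI)
  then show ?thesis by simp
qed

context measure_valued_diffusion
begin

lemma state_finite: "0 \<le> t \<Longrightarrow> \<omega> \<in> space \<Omega> \<Longrightarrow> X t \<omega> \<in> finite_measures"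
  using measurable_X[of t] by (auto dest: measurable_space simp: space_finite_measure_algebra)

lemma space_P: "\<mu> \<in> finite_measures \<Longrightarrow> space (P \<mu>) = space \<Omega>"
  by (intro sets_eq_imp_space_eq sets_P)

lemma measurable_X_P: 
  assumes "\<mu> \<in> finite_measures" "0 \<le> t"
  shows "X t \<in> measurable (P \<mu>) finite_measure_algebra"
  using measurable_X[OF assms(2)] sets_P[OF assms(1)] by (simp cong: measurable_cong_sets)

definition barrier_functional :: "('a \<Rightarrow> ennreal) \<Rightarrow> 'a measure \<Rightarrow> real" where
  "barrier_functional U \<nu> = exp_neg (\<integral>\<^sup>+ x. U x \<partial>\<nu>)"

lemma measurable_barrier_functional:
  assumes "approximable_from_below U"
  shows "barrier_functional U \<in> borel_measurable finite_measure_algebra"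
  unfolding barrier_functional_def
  using measurable_nn_integral_finite_measures[OF measurable_approximable[OF assms]] by measurable

text \<open>For continuous \<open>f\<close> of compact support with \<open>f \<le> U\<close> the log-Laplace formula gives
  \<open>E\<^sub>\<mu> (exp (- \<langle>f, X t\<rangle>)) = exp (- \<langle>u, \<mu>\<rangle>)\<close> with a solution \<open>u\<close> started at \<open>f\<close>, and \<open>u \<le> U\<close> because
  \<open>U\<close> is a barrier. Now let \<open>f\<close> increase to \<open>U\<close>.\<close>

lemma barrier_functional_submean:
  assumes U: "barrier L \<beta> \<alpha> p U" "approximable_from_below U" and \<mu>: "\<mu> \<in> finite_measures" and t: "0 \<le> t"
  shows "ennreal (barrier_functional U \<mu>) \<le> (\<integral>\<^sup>+ \<omega>. barrier_functional U (X t \<omega>) \<partial>P \<mu>)"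
proof -
  interpret prob_space "P \<mu>" using prob_space_P[OF \<mu>] .
  obtain f :: "nat \<Rightarrow> 'a \<Rightarrow> real" where cont: "\<And>k. continuous_on UNIV (f k)" 
    and f0: "\<And>k x. 0 \<le> f k x" and cpt: "\<And>k. compact (closure {x. f k x \<noteq> 0})"
    and inc: "\<And>x. incseq (\<lambda>k. f k x)" and SUP: "\<And>x. U x = (SUP k. ennreal (f k x))"
    using U(2) unfolding approximable_from_below_def by blast
  have fU: "ennreal (f k x) \<le> U x" for k x
    unfolding SUP by (rule SUP_upper) simp
  have int: "integrable \<nu> (f k)" if "\<nu> \<in> finite_measures" for \<nu> k
    using integrable_compact_support[OF cont cpt that] .
  have meas: "(\<lambda>\<omega>. exp (- (\<integral>x. f k x \<partial>X t \<omega>))) \<in> borel_measurable (P \<mu>)" for k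
  proof -
    have "(\<integral>x. f k x \<partial>X t \<omega>) = enn2real (\<integral>\<^sup>+ x. ennreal (f k x) \<partial>X t \<omega>)" if "\<omega> \<in> space (P \<mu>)" for \<omega>
      using int[OF state_finite[OF t]] that \<mu> by (subst integral_eq_nn_integral) (auto simp: space_P f0)
    then have eq: "exp (- (\<integral>x. f k x \<partial>X t \<omega>)) = exp (- enn2real (\<integral>\<^sup>+ x. ennreal (f k x) \<partial>X t \<omega>))"
      if "\<omega> \<in> space (P \<mu>)" for \<omega>
      using that by simp
    have "(\<lambda>\<nu>. \<integral>\<^sup>+ x. ennreal (f k x) \<partial>\<nu>) \<in> borel_measurable finite_measure_algebra"
      using borel_measurable_continuous_onI[OF cont[of k]] by (intro measurable_nn_integral_finite_measures) simp
    from measurable_compose[OF measurable_X_P[OF \<mu> t] this]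
    have [measurable]: "(\<lambda>\<omega>. \<integral>\<^sup>+ x. ennreal (f k x) \<partial>X t \<omega>) \<in> borel_measurable (P \<mu>)" .
    have "(\<lambda>\<omega>. exp (- enn2real (\<integral>\<^sup>+ x. ennreal (f k x) \<partial>X t \<omega>))) \<in> borel_measurable (P \<mu>)"
      by measurable
    then show ?thesis
      using eq by (subst measurable_cong) auto
  qed
  have meas\<Phi>: "(\<lambda>\<omega>. barrier_functional U (X t \<omega>)) \<in> borel_measurable (P \<mu>)"
    using measurable_compose[OF measurable_X_P[OF \<mu> t] measurable_barrier_functional[OF U(2)]] .
  have "(\<lambda>k. \<integral>\<omega>. exp (- (\<integral>x. f k x \<partial>X t \<omega>)) \<partial>P \<mu>) \<longlonglongrightarrow> (\<integral>\<omega>. barrier_functional U (X t \<omega>) \<partial>P \<mu>)"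
  proof (rule integral_dominated_convergence[where w = "\<lambda>_. 1"])
    show "AE \<omega> in P \<mu>. (\<lambda>k. exp (- (\<integral>x. f k x \<partial>X t \<omega>))) \<longlonglongrightarrow> barrier_functional U (X t \<omega>)"
    proof (rule AE_I2)
      fix \<omega> assume "\<omega> \<in> space (P \<mu>)"
      then have "X t \<omega> \<in> finite_measures"
        using state_finite[OF t] by (simp add: space_P[OF \<mu>])
      then show "(\<lambda>k. exp (- (\<integral>x. f k x \<partial>X t \<omega>))) \<longlonglongrightarrow> barrier_functional U (X t \<omega>)"
        unfolding barrier_functional_def by (intro exp_integral_tendsto_exp_neg f0 inc int SUP)
    qed
    show "AE \<omega> in P \<mu>. norm (exp (- (\<integral>x. f k x \<partial>X t \<omega>))) \<le> 1" for k
      using f0 by (intro AE_I2) simp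
  qed (use meas meas\<Phi> in auto)
  moreover have "barrier_functional U \<mu> \<le> (\<integral>\<omega>. exp (- (\<integral>x. f k x \<partial>X t \<omega>)) \<partial>P \<mu>)" for k
  proof -
    obtain u where u: "classical_solution L \<beta> \<alpha> p (f k) u"
      and eq: "(\<integral>\<omega>. exp (- (\<integral>x. f k x \<partial>X t \<omega>)) \<partial>P \<mu>) = exp (- (\<integral>x. u x t \<partial>\<mu>))"
      using log_laplace[OF cont f0 cpt] \<mu> t unfolding minimal_solution_def by blast
    have "ennreal (u x t) \<le> U x" for x
      using U(1) u fU t unfolding barrier_def by blast
    moreover have "0 \<le> u x t" for x
      using u t by (simp add: classical_solution_def)
    ultimately show ?thesis
      unfolding eq barrier_functional_def by (intro exp_neg_le_exp_integral)
  qed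
  ultimately have "barrier_functional U \<mu> \<le> (\<integral>\<omega>. barrier_functional U (X t \<omega>) \<partial>P \<mu>)"
    by (intro LIMSEQ_le_const) auto
  moreover have "integrable (P \<mu>) (\<lambda>\<omega>. barrier_functional U (X t \<omega>))"
    using meas\<Phi> by (intro integrable_const_bound[where B = 1])
      (auto simp: barrier_functional_def exp_neg_bounds)
  ultimately show ?thesis
    by (subst nn_integral_eq_integral)
      (auto simp: barrier_functional_def exp_neg_bounds intro!: ennreal_leI)
qed

text \<open>The Markov property, stated for indicators and conditional expectations, says that two finite
  measures on the state space agree: the law of \<open>X (s + t)\<close> on the event \<open>E\<close>, and the mixture of the
  transition laws started from \<open>X s\<close> on \<open>E\<close>. Hence they integrate every \<open>\<Phi>\<close> to the same value.\<close>

lemma markov_nn_integral: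
  assumes \<mu>: "\<mu> \<in> finite_measures" and s: "0 \<le> s" and t: "0 \<le> t"
    and E: "E \<in> sets (natural_filtration \<Omega> finite_measure_algebra X s)"
    and \<Phi>: "\<Phi> \<in> borel_measurable finite_measure_algebra"
  shows "(\<integral>\<^sup>+ \<omega>. indicator E \<omega> * \<Phi> (X (s + t) \<omega>) \<partial>P \<mu>)
     = (\<integral>\<^sup>+ \<omega>. indicator E \<omega> * (\<integral>\<^sup>+ \<omega>'. \<Phi> (X t \<omega>') \<partial>P (X s \<omega>)) \<partial>P \<mu>)"
proof -
  interpret prob_space "P \<mu>" using prob_space_P[OF \<mu>] .
  let ?F = "natural_filtration \<Omega> finite_measure_algebra X s"
  have sub: "subalgebra (P \<mu>) ?F"
    using natural_filtration_subalgebra[OF measurable_X sets_P[OF \<mu>] s] .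
  interpret finite_measure_subalgebra "P \<mu>" ?F
    by unfold_locales (rule sub)
  have EP [measurable]: "E \<in> sets (P \<mu>)"
    using E sub by (auto simp: subalgebra_def)
  have Xm [measurable]: "X r \<in> measurable (P \<mu>) finite_measure_algebra" if "0 \<le> r" for r
    using measurable_X_P[OF \<mu> that] .
  define K where "K \<nu> = distr (P \<nu>) finite_measure_algebra (X t)" for \<nu>
  define M where "M = density (P \<mu>) (indicator E)"
  have K: "K \<in> measurable finite_measure_algebra (subprob_algebra finite_measure_algebra)"
    unfolding K_def using kernel[OF t] by (rule measurable_prob_algebraD)
  have KX: "(\<lambda>\<omega>. K (X s \<omega>)) \<in> measurable M (subprob_algebra finite_measure_algebra)"
    using measurable_compose[OF Xm[OF s] K] by (simp add: M_def)
  have sp: "space M \<noteq> {}"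
    using not_empty by (simp add: M_def)
  have Kprob: "prob_space (K \<nu>)" if "\<nu> \<in> finite_measures" for \<nu>
    unfolding K_def using prob_space_P[OF that] measurable_X_P[OF that t] by (rule prob_space.prob_space_distr)
  have "distr M finite_measure_algebra (X (s + t)) = M \<bind> (\<lambda>\<omega>. K (X s \<omega>))"
  proof (rule measure_eqI)
    show "sets (distr M finite_measure_algebra (X (s + t))) = sets (M \<bind> (\<lambda>\<omega>. K (X s \<omega>)))"
      using sets_bind_measurable[OF KX sp] by simp
  next
    fix B assume "B \<in> sets (distr M finite_measure_algebra (X (s + t)))"
    then have B [measurable]: "B \<in> sets finite_measure_algebra" by simp
    have st: "0 \<le> s + t" using s t by simp
    define g :: "'w \<Rightarrow> real" where "g \<omega> = indicator B (X (s + t) \<omega>)" for \<omega>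
    have gm: "g \<in> borel_measurable (P \<mu>)"
      unfolding g_def using Xm[OF st] by measurable
    have gi: "integrable (P \<mu>) g"
      using gm by (intro integrable_const_bound[where B = 1]) (auto simp: g_def indicator_def)
    have hm: "(\<lambda>\<omega>. measure (K (X s \<omega>)) B) \<in> borel_measurable (P \<mu>)"
    proof -
      have "(\<lambda>\<nu>. measure (K \<nu>) B) \<in> borel_measurable finite_measure_algebra"
        using measurable_compose[OF K measurable_emeasure_subprob_algebra[OF B]] by (simp add: measure_def)
      then show ?thesis using Xm[OF s] by (rule measurable_compose[rotated])
    qed
    have hb: "measure (K (X s \<omega>)) B \<le> 1" if "\<omega> \<in> space (P \<mu>)" for \<omega>
      using that by (intro prob_space.prob_le_1 Kprob state_finite s) (simp add: space_P[OF \<mu>])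
    have hi: "integrable (P \<mu>) (\<lambda>\<omega>. measure (K (X s \<omega>)) B)"
      using hm hb by (intro integrable_const_bound[where B = 1]) (auto intro!: AE_I2)
    have "emeasure (distr M finite_measure_algebra (X (s + t))) B
        = (\<integral>\<^sup>+ \<omega>. indicator B \<omega> \<partial>distr M finite_measure_algebra (X (s + t)))"
      by simp
    also have "\<dots> = (\<integral>\<^sup>+ \<omega>. indicator B (X (s + t) \<omega>) \<partial>M)"
      using Xm[OF st] by (intro nn_integral_distr) (auto simp: M_def)
    also have "\<dots> = (\<integral>\<^sup>+ \<omega>. indicator E \<omega> * indicator B (X (s + t) \<omega>) \<partial>P \<mu>)"
      unfolding M_def using Xm[OF st] by (intro nn_integral_density) auto
    also have "\<dots> = (\<integral>\<^sup>+ \<omega>. ennreal (indicator E \<omega> * g \<omega>) \<partial>P \<mu>)"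
      by (intro nn_integral_cong) (auto simp: g_def indicator_def)
    also have "\<dots> = ennreal (\<integral>\<omega>. indicator E \<omega> * g \<omega> \<partial>P \<mu>)"
      using gi integrable_real_mult_indicator[OF EP gi] 
      by (intro nn_integral_eq_integral) (auto simp: g_def mult.commute)
    also have "(\<integral>\<omega>. indicator E \<omega> * g \<omega> \<partial>P \<mu>) = (\<integral>\<omega>\<in>E. g \<omega> \<partial>P \<mu>)"
      by (simp add: set_lebesgue_integral_def)
    also have "\<dots> = (\<integral>\<omega>\<in>E. real_cond_exp (P \<mu>) ?F g \<omega> \<partial>P \<mu>)"
      using real_cond_exp_intA[OF gi E] .
    also have "\<dots> = (\<integral>\<omega>\<in>E. measure (K (X s \<omega>)) B \<partial>P \<mu>)"
    proof -
      have "AE \<omega> in P \<mu>. \<omega> \<in> E \<longrightarrow> real_cond_exp (P \<mu>) ?F g \<omega> = measure (K (X s \<omega>)) B"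
        using markov[OF \<mu> s t B] unfolding g_def K_def by eventually_elim simp
      then show ?thesis
        unfolding set_lebesgue_integral_def
        using hm by (intro integral_cong_AE) (auto simp: indicator_def split: if_splits)
    qed
    also have "\<dots> = (\<integral>\<omega>. indicator E \<omega> * measure (K (X s \<omega>)) B \<partial>P \<mu>)"
      by (simp add: set_lebesgue_integral_def)
    also have "ennreal \<dots> = (\<integral>\<^sup>+ \<omega>. ennreal (indicator E \<omega> * measure (K (X s \<omega>)) B) \<partial>P \<mu>)"
      using integrable_real_mult_indicator[OF EP hi]
      by (intro nn_integral_eq_integral[symmetric]) (auto simp: mult.commute)
    also have "\<dots> = (\<integral>\<^sup>+ \<omega>. indicator E \<omega> * emeasure (K (X s \<omega>)) B \<partial>P \<mu>)"
    proof (intro nn_integral_cong)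
      fix \<omega> assume "\<omega> \<in> space (P \<mu>)"
      then interpret K: prob_space "K (X s \<omega>)"
        by (intro Kprob state_finite s) (simp add: space_P[OF \<mu>])
      show "ennreal (indicator E \<omega> * measure (K (X s \<omega>)) B) = indicator E \<omega> * emeasure (K (X s \<omega>)) B"
        by (simp add: K.emeasure_eq_measure indicator_def)
    qed
    also have "\<dots> = (\<integral>\<^sup>+ \<omega>. emeasure (K (X s \<omega>)) B \<partial>M)"
      unfolding M_def using measurable_compose[OF measurable_compose[OF Xm[OF s] K] measurable_emeasure_subprob_algebra[OF B]]
      by (intro nn_integral_density[symmetric]) auto
    also have "\<dots> = emeasure (M \<bind> (\<lambda>\<omega>. K (X s \<omega>))) B"
      using emeasure_bind[OF sp KX B] by simp
    finally show "emeasure (distr M finite_measure_algebra (X (s + t))) B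
        = emeasure (M \<bind> (\<lambda>\<omega>. K (X s \<omega>))) B" .
  qed
  then have *: "(\<integral>\<^sup>+ \<nu>. \<Phi> \<nu> \<partial>distr M finite_measure_algebra (X (s + t)))
      = (\<integral>\<^sup>+ \<omega>. \<integral>\<^sup>+ \<nu>. \<Phi> \<nu> \<partial>K (X s \<omega>) \<partial>M)"
    using nn_integral_bind[OF \<Phi> KX] by simp
  have **: "(\<integral>\<^sup>+ \<nu>. \<Phi> \<nu> \<partial>distr M finite_measure_algebra (X (s + t)))
      = (\<integral>\<^sup>+ \<omega>. indicator E \<omega> * \<Phi> (X (s + t) \<omega>) \<partial>P \<mu>)"
  proof -
    have "X (s + t) \<in> measurable (P \<mu>) finite_measure_algebra" using Xm s t by simp
    then show ?thesis
      using \<Phi> unfolding M_def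
      by (subst nn_integral_distr) (auto intro!: nn_integral_density)
  qed
  have "(\<lambda>\<omega>. \<integral>\<^sup>+ \<nu>. \<Phi> \<nu> \<partial>K (X s \<omega>)) \<in> borel_measurable (P \<mu>)"
    using measurable_compose[OF measurable_compose[OF Xm[OF s] K] nn_integral_measurable_subprob_algebra[OF \<Phi>]] .
  then have "(\<integral>\<^sup>+ \<omega>. \<integral>\<^sup>+ \<nu>. \<Phi> \<nu> \<partial>K (X s \<omega>) \<partial>M) = (\<integral>\<^sup>+ \<omega>. indicator E \<omega> * (\<integral>\<^sup>+ \<nu>. \<Phi> \<nu> \<partial>K (X s \<omega>)) \<partial>P \<mu>)"
    unfolding M_def by (intro nn_integral_density) auto
  also have "\<dots> = (\<integral>\<^sup>+ \<omega>. indicator E \<omega> * (\<integral>\<^sup>+ \<omega>'. \<Phi> (X t \<omega>') \<partial>P (X s \<omega>)) \<partial>P \<mu>)"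
  proof (intro nn_integral_cong)
    fix \<omega> assume "\<omega> \<in> space (P \<mu>)"
    then have "X t \<in> measurable (P (X s \<omega>)) finite_measure_algebra"
      by (intro measurable_X_P state_finite s t) (simp add: space_P[OF \<mu>])
    then show "indicator E \<omega> * (\<integral>\<^sup>+ \<nu>. \<Phi> \<nu> \<partial>K (X s \<omega>)) = indicator E \<omega> * (\<integral>\<^sup>+ \<omega>'. \<Phi> (X t \<omega>') \<partial>P (X s \<omega>))"
      unfolding K_def using \<Phi> by (simp add: nn_integral_distr)
  qed
  finally show ?thesis
    using * ** by simp
qed

text \<open>The maximal inequality for the nonnegative supermartingale \<open>1 - \<Phi> (X t)\<close>, where
  \<open>\<Phi> = barrier_functional U\<close>. Since \<open>\<Phi> \<le> 1\<close>, it is enough to bound \<open>E (\<Phi> (X t); E\<^sub>T)\<close> from below,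
  where \<open>E\<^sub>T\<close> is the event that \<open>\<Phi> (X s)\<close> is nonzero for all \<open>s \<in> T\<close>. Adding a last time \<open>r\<close> to
  \<open>T\<close> costs nothing, because \<open>\<Phi> (X r)\<close> vanishes on the part of \<open>E\<^sub>T\<close> that is lost. The bound does not
  depend on \<open>T\<close>, so it survives the passage to countably many times.\<close>

lemma barrier_functional_survival:
  assumes U: "barrier L \<beta> \<alpha> p U" "approximable_from_below U" and \<mu>: "\<mu> \<in> finite_measures"
    and "finite T" "T \<subseteq> {0..}"
  shows "ennreal (barrier_functional U \<mu>)
    \<le> emeasure (P \<mu>) {\<omega> \<in> space (P \<mu>). \<forall>s\<in>T. barrier_functional U (X s \<omega>) \<noteq> 0}"
proof -
  let ?\<Phi> = "barrier_functional U"
  let ?E = "\<lambda>T. {\<omega> \<in> space \<Omega>. \<forall>s\<in>T. ?\<Phi> (X s \<omega>) \<noteq> 0}"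
  note \<Phi>m [measurable] = measurable_barrier_functional[OF U(2)]
  have bounded: "\<exists>t\<ge>0. T \<subseteq> {0..t}" if "finite T" "T \<subseteq> {0..}" for T :: "real set"
    using that by (intro exI[of _ "Max (insert 0 T)"]) (auto intro!: Max_ge)
  have E_F: "?E T \<in> sets (natural_filtration \<Omega> finite_measure_algebra X t)"
    if "finite T" "T \<subseteq> {0..t}" "0 \<le> t" for T t
  proof -
    let ?F = "natural_filtration \<Omega> finite_measure_algebra X t"
    have "space ?F = space \<Omega>"
      using natural_filtration_subalgebra[of X \<Omega> _ \<Omega> t, OF measurable_X _ \<open>0 \<le> t\<close>] by (simp add: subalgebra_def)
    moreover have "{\<omega> \<in> space ?F. \<forall>s\<in>T. ?\<Phi> (X s \<omega>) \<noteq> 0} \<in> sets ?F"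
    proof (rule sets.sets_Collect_finite_All)
      fix s assume "s \<in> T"
      then have "X s \<in> measurable ?F finite_measure_algebra"
        using that by (intro measurable_natural_filtration measurable_X) auto
      then have [measurable]: "(\<lambda>\<omega>. ?\<Phi> (X s \<omega>)) \<in> borel_measurable ?F"
        by measurable
      show "{\<omega> \<in> space ?F. ?\<Phi> (X s \<omega>) \<noteq> 0} \<in> sets ?F"
        by measurable
    qed (rule that)
    ultimately show ?thesis by simp
  qed
  have E_P: "?E T \<in> sets (P \<mu>)" if T: "finite T" "T \<subseteq> {0..}" for T
  proof -
    obtain t where t: "T \<subseteq> {0..t}" "0 \<le> t"
      using bounded[OF T] by blast
    show ?thesis
      using E_F[OF \<open>finite T\<close> t] natural_filtration_subalgebra[of X \<Omega> finite_measure_algebra "P \<mu>" t, OF measurable_X sets_P[OF \<mu>] t(2)]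
      by (auto simp: subalgebra_def)
  qed
  have main: "ennreal (?\<Phi> \<mu>) \<le> (\<integral>\<^sup>+ \<omega>. indicator (?E T) \<omega> * ennreal (?\<Phi> (X t \<omega>)) \<partial>P \<mu>)"
    if "finite T" "T \<subseteq> {0..t}" "0 \<le> t" for T t
    using that
  proof (induction T arbitrary: t rule: finite_linorder_max_induct)
    case empty
    have "(\<integral>\<^sup>+ \<omega>. indicator (?E {}) \<omega> * ennreal (?\<Phi> (X t \<omega>)) \<partial>P \<mu>) = (\<integral>\<^sup>+ \<omega>. ?\<Phi> (X t \<omega>) \<partial>P \<mu>)"
      by (intro nn_integral_cong) (auto simp: space_P[OF \<mu>])
    then show ?case
      using barrier_functional_submean[OF U \<mu>] empty by simp
  next
    case (insert r T)
    have r: "0 \<le> r" "r \<le> t" using insert.prems by auto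
    have Tr: "T \<subseteq> {0..r}" using insert.hyps insert.prems by (auto simp: subset_eq less_imp_le)
    have "ennreal (?\<Phi> \<mu>) \<le> (\<integral>\<^sup>+ \<omega>. indicator (?E T) \<omega> * ennreal (?\<Phi> (X r \<omega>)) \<partial>P \<mu>)"
      using insert.IH[OF Tr r(1)] .
    also have "\<dots> = (\<integral>\<^sup>+ \<omega>. indicator (?E (insert r T)) \<omega> * ennreal (?\<Phi> (X r \<omega>)) \<partial>P \<mu>)"
      by (intro nn_integral_cong) (auto simp: indicator_def)
    also have "\<dots> \<le> (\<integral>\<^sup>+ \<omega>. indicator (?E (insert r T)) \<omega> *
        (\<integral>\<^sup>+ \<omega>'. ennreal (?\<Phi> (X (t - r) \<omega>')) \<partial>P (X r \<omega>)) \<partial>P \<mu>)"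
      using r by (intro nn_integral_mono mult_left_mono barrier_functional_submean[OF U] state_finite)
        (auto simp: space_P[OF \<mu>])
    also have "\<dots> = (\<integral>\<^sup>+ \<omega>. indicator (?E (insert r T)) \<omega> * ennreal (?\<Phi> (X (r + (t - r)) \<omega>)) \<partial>P \<mu>)"
      using r Tr insert.hyps by (intro markov_nn_integral[symmetric] \<mu> E_F) auto
    finally show ?case by simp
  qed
  obtain t where t: "T \<subseteq> {0..t}" "0 \<le> t"
    using bounded[OF assms(4,5)] by blast
  have "ennreal (?\<Phi> \<mu>) \<le> (\<integral>\<^sup>+ \<omega>. indicator (?E T) \<omega> * ennreal (?\<Phi> (X t \<omega>)) \<partial>P \<mu>)"
    using main[OF \<open>finite T\<close> t] .
  also have "\<dots> \<le> (\<integral>\<^sup>+ \<omega>. indicator (?E T) \<omega> \<partial>P \<mu>)"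
    by (intro nn_integral_mono) (auto simp: indicator_def barrier_functional_def exp_neg_bounds)
  also have "\<dots> = emeasure (P \<mu>) (?E T)"
    using E_P assms by simp
  finally show ?thesis by (simp add: space_P[OF \<mu>])
qed

lemma barrier_functional_survival_countable:
  assumes U: "barrier L \<beta> \<alpha> p U" "approximable_from_below U" and \<mu>: "\<mu> \<in> finite_measures"
    and "countable T" "T \<subseteq> {0..}"
  shows "{\<omega> \<in> space (P \<mu>). \<forall>s\<in>T. barrier_functional U (X s \<omega>) \<noteq> 0} \<in> sets (P \<mu>)" (is "?S T \<in> _")
    and "ennreal (barrier_functional U \<mu>)
    \<le> emeasure (P \<mu>) {\<omega> \<in> space (P \<mu>). \<forall>s\<in>T. barrier_functional U (X s \<omega>) \<noteq> 0}"
proof -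
  interpret prob_space "P \<mu>" using prob_space_P[OF \<mu>] .
  note \<Phi>m [measurable] = measurable_barrier_functional[OF U(2)]
  have S: "?S T \<in> sets (P \<mu>)" if "countable T" "T \<subseteq> {0..}" for T
  proof (rule sets.sets_Collect_countable_All')
    fix s assume "s \<in> T"
    then have [measurable]: "X s \<in> measurable (P \<mu>) finite_measure_algebra"
      using that \<mu> by (intro measurable_X_P) auto
    show "{\<omega> \<in> space (P \<mu>). barrier_functional U (X s \<omega>) \<noteq> 0} \<in> sets (P \<mu>)"
      by measurable
  qed (rule that)
  show "?S T \<in> sets (P \<mu>)" using S assms by simp
  show "ennreal (barrier_functional U \<mu>) \<le> emeasure (P \<mu>) (?S T)"
  proof (cases "T = {}")
    case True
    then show ?thesis
      by (simp add: emeasure_space_1 barrier_functional_def exp_neg_bounds)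
  next
    case False
    define q where "q = from_nat_into T"
    have q: "range q = T" unfolding q_def using False \<open>countable T\<close> by (rule range_from_nat_into)
    have eq: "?S T = (\<Inter>n. ?S (q ` {..n}))"
      unfolding q[symmetric] by auto
    have "emeasure (P \<mu>) (\<Inter>n. ?S (q ` {..n})) = (INF n. emeasure (P \<mu>) (?S (q ` {..n})))"
    proof (rule INF_emeasure_decseq[symmetric])
      show "range (\<lambda>n. ?S (q ` {..n})) \<subseteq> sets (P \<mu>)"
        using q assms(5) by (intro image_subsetI S) auto
    qed (auto simp: decseq_def)
    moreover have "ennreal (barrier_functional U \<mu>) \<le> emeasure (P \<mu>) (?S (q ` {..n}))" for n
      using q assms(5) by (intro barrier_functional_survival U \<mu>) auto
    ultimately show ?thesis
      unfolding eq by (auto intro: INF_greatest)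
  qed
qed

end

section \<open>Derivatives of radial functions\<close>

lemma partial_eqI:
  assumes "(f has_derivative f') (at x)"
  shows "partial b f x = f' b"
  by (simp add: partial_def frechet_derivative_at[OF assms, symmetric])

lemma partial_radial:
  fixes x :: "'a::euclidean_space"
  assumes "(g has_real_derivative d) (at (x \<bullet> x))"
  shows "((\<lambda>y. g (y \<bullet> y)) has_derivative (\<lambda>h. 2 * d * (x \<bullet> h))) (at x)"
    and "partial b (\<lambda>y. g (y \<bullet> y)) x = 2 * d * (x \<bullet> b)"
proof -
  have "((\<lambda>y. y \<bullet> y) has_derivative (\<lambda>h. x \<bullet> h + h \<bullet> x)) (at x)"
    by (rule has_derivative_inner) (auto intro: has_derivative_ident)
  then have "((\<lambda>y. g (y \<bullet> y)) has_derivative (\<lambda>h. d * (x \<bullet> h + h \<bullet> x))) (at x)"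
    using has_derivative_compose[of "\<lambda>y. y \<bullet> y" _ x UNIV g "\<lambda>h. d * h"] assms
    by (simp add: has_field_derivative_def)
  then show *: "((\<lambda>y. g (y \<bullet> y)) has_derivative (\<lambda>h. 2 * d * (x \<bullet> h))) (at x)"
    by (simp add: inner_commute algebra_simps)
  show "partial b (\<lambda>y. g (y \<bullet> y)) x = 2 * d * (x \<bullet> b)"
    by (rule partial_eqI[OF *])
qed

lemma partial_partial_radial:
  fixes x :: "'a::euclidean_space" and g g' g'' :: "real \<Rightarrow> real"
  assumes "open I" "x \<bullet> x \<in> I"
    and g: "\<And>\<rho>. \<rho> \<in> I \<Longrightarrow> (g has_real_derivative g' \<rho>) (at \<rho>)"
    and g': "\<And>\<rho>. \<rho> \<in> I \<Longrightarrow> (g' has_real_derivative g'' \<rho>) (at \<rho>)"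
  shows "partial b (\<lambda>y. g (y \<bullet> y)) differentiable (at x)"
    and "partial c (partial b (\<lambda>y. g (y \<bullet> y))) x
      = 2 * g' (x \<bullet> x) * (c \<bullet> b) + 4 * g'' (x \<bullet> x) * (x \<bullet> b) * (x \<bullet> c)"
proof -
  have "((\<lambda>y. 2 * g' (y \<bullet> y) * (y \<bullet> b)) has_derivative
     (\<lambda>h. 2 * g' (x \<bullet> x) * (h \<bullet> b) + 4 * g'' (x \<bullet> x) * (x \<bullet> b) * (x \<bullet> h))) (at x)"
    using partial_radial(1)[OF g'[OF assms(2)]]
    by (auto intro!: derivative_eq_intros simp: algebra_simps)
  then have *: "(partial b (\<lambda>y. g (y \<bullet> y)) has_derivative
     (\<lambda>h. 2 * g' (x \<bullet> x) * (h \<bullet> b) + 4 * g'' (x \<bullet> x) * (x \<bullet> b) * (x \<bullet> h))) (at x)"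
  proof (rule has_derivative_transform_within_open)
    show "open ((\<lambda>y. y \<bullet> y) -` I)"
      using assms(1) by (intro open_vimage continuous_intros)
    show "2 * g' (y \<bullet> y) * (y \<bullet> b) = partial b (\<lambda>y. g (y \<bullet> y)) y" if "y \<in> (\<lambda>y. y \<bullet> y) -` I" for y
      using that partial_radial(2)[OF g, of y b] by simp
  qed (use assms(2) in auto)
  show "partial b (\<lambda>y. g (y \<bullet> y)) differentiable (at x)"
    using * by (auto simp: differentiable_def)
  show "partial c (partial b (\<lambda>y. g (y \<bullet> y))) x
      = 2 * g' (x \<bullet> x) * (c \<bullet> b) + 4 * g'' (x \<bullet> x) * (x \<bullet> b) * (x \<bullet> c)"
    by (rule partial_eqI[OF *])
qed

lemma laplacian_radial:
  fixes x :: "'a::euclidean_space" and g g' g'' :: "real \<Rightarrow> real"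
  assumes "open I" "x \<bullet> x \<in> I"
    and "\<And>\<rho>. \<rho> \<in> I \<Longrightarrow> (g has_real_derivative g' \<rho>) (at \<rho>)"
    and "\<And>\<rho>. \<rho> \<in> I \<Longrightarrow> (g' has_real_derivative g'' \<rho>) (at \<rho>)"
  shows "laplacian (\<lambda>y. g (y \<bullet> y)) x = 2 * DIM('a) * g' (x \<bullet> x) + 4 * (x \<bullet> x) * g'' (x \<bullet> x)"
proof -
  have "laplacian (\<lambda>y. g (y \<bullet> y)) x
      = (\<Sum>b\<in>Basis. 2 * g' (x \<bullet> x) + 4 * g'' (x \<bullet> x) * ((x \<bullet> b) * (x \<bullet> b)))"
    unfolding laplacian_def
    by (intro sum.cong) (auto simp: partial_partial_radial(2)[OF assms])
  also have "\<dots> = 2 * DIM('a) * g' (x \<bullet> x) + 4 * g'' (x \<bullet> x) * (\<Sum>b\<in>Basis. (x \<bullet> b) * (x \<bullet> b))"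
    by (simp add: sum.distrib sum_distrib_left)
  also have "(\<Sum>b\<in>Basis. (x \<bullet> b) * (x \<bullet> b)) = x \<bullet> x"
    by (rule euclidean_inner[symmetric])
  finally show ?thesis
    by (simp add: algebra_simps)
qed

section \<open>The maximum principle\<close>

lemma second_derivative_local_max:
  fixes \<phi> \<psi> :: "real \<Rightarrow> real"
  assumes "\<forall>\<^sub>F h in nhds 0. (\<phi> has_real_derivative \<psi> h) (at h)"
    and "(\<psi> has_real_derivative c) (at 0)"
    and "\<forall>\<^sub>F h in nhds 0. \<phi> h \<le> \<phi> 0"
  shows "c \<le> 0"
proof (rule ccontr)
  assume "\<not> c \<le> 0"
  then have "0 < c" by simp
  obtain d where "0 < d"
    and d': "\<forall>h. dist h 0 < d \<longrightarrow> (\<phi> has_real_derivative \<psi> h) (at h) \<and> \<phi> h \<le> \<phi> 0"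
    using eventually_conj[OF assms(1,3)] unfolding eventually_nhds_metric by blast
  then have d: "(\<phi> has_real_derivative \<psi> h) (at h)" "\<phi> h \<le> \<phi> 0" if "\<bar>h\<bar> < d" for h
    using that by (simp_all add: dist_real_def)
  have "\<psi> 0 = 0"
    using DERIV_local_max[OF d(1) \<open>0 < d\<close>] d(2) \<open>0 < d\<close> by simp
  obtain e where "0 < e" and e: "\<And>h. 0 < h \<Longrightarrow> h < e \<Longrightarrow> \<psi> 0 < \<psi> (0 + h)"
    using DERIV_pos_inc_right[OF assms(2) \<open>0 < c\<close>] by blast
  define h where "h = min d e / 2"
  have h: "0 < h" "h < d" "h < e"
    using \<open>0 < d\<close> \<open>0 < e\<close> by (auto simp: h_def min_def)
  obtain z where z: "0 < z" "z < h" "\<phi> h - \<phi> 0 = (h - 0) * \<psi> z"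
    using MVT2[of 0 h \<phi> \<psi>] d(1) h by auto
  have "0 < \<psi> z"
    using e[of z] z h \<open>\<psi> 0 = 0\<close> by simp
  then have "0 < \<phi> h - \<phi> 0"
    using z h by simp
  then show False
    using d(2)[of h] h by simp
qed

lemma has_real_derivative_along_line:
  fixes f :: "'a::euclidean_space \<Rightarrow> real"
  assumes "f differentiable (at (x + h *\<^sub>R b))"
  shows "((\<lambda>t. f (x + t *\<^sub>R b)) has_real_derivative partial b f (x + h *\<^sub>R b)) (at h)"
proof -
  let ?F = "frechet_derivative f (at (x + h *\<^sub>R b))"
  have f: "(f has_derivative ?F) (at (x + h *\<^sub>R b))"
    using assms by (simp add: frechet_derivative_works)
  have "((\<lambda>t. x + t *\<^sub>R b) has_derivative (\<lambda>t. t *\<^sub>R b)) (at h)"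
    by (auto intro!: derivative_eq_intros)
  from has_derivative_compose[OF this f]
  have "((\<lambda>t. f (x + t *\<^sub>R b)) has_derivative (\<lambda>t. ?F (t *\<^sub>R b))) (at h)" .
  moreover have "?F (t *\<^sub>R b) = partial b f (x + h *\<^sub>R b) * t" for t
    using linear_scale[OF has_derivative_linear[OF f]] by (simp add: partial_def)
  ultimately show ?thesis
    by (simp add: has_field_derivative_def)
qed

text \<open>The second derivative test, applied to \<open>f - g\<close> along each coordinate direction.\<close>

lemma laplacian_le_at_local_max:
  fixes f g :: "'a::euclidean_space \<Rightarrow> real"
  assumes f: "\<forall>\<^sub>F y in nhds x. f differentiable (at y)" "\<And>b. b \<in> Basis \<Longrightarrow> partial b f differentiable (at x)"
    and g: "\<forall>\<^sub>F y in nhds x. g differentiable (at y)" "\<And>b. b \<in> Basis \<Longrightarrow> partial b g differentiable (at x)"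
    and max: "\<forall>\<^sub>F y in nhds x. f y - g y \<le> f x - g x"
  shows "laplacian f x \<le> laplacian g x"
  unfolding laplacian_def
proof (rule sum_mono)
  fix b :: 'a assume b: "b \<in> Basis"
  have line: "filterlim (\<lambda>h. x + h *\<^sub>R b) (nhds x) (nhds (0::real))"
  proof -
    have "((\<lambda>h. x + h *\<^sub>R b) \<longlongrightarrow> x + 0 *\<^sub>R b) (nhds (0::real))"
      by (intro tendsto_intros filterlim_ident)
    then show ?thesis by simp
  qed
  have "partial b (partial b f) x - partial b (partial b g) x \<le> 0"
  proof (rule second_derivative_local_max)
    show "\<forall>\<^sub>F h in nhds 0. ((\<lambda>h. f (x + h *\<^sub>R b) - g (x + h *\<^sub>R b)) has_real_derivative
        partial b f (x + h *\<^sub>R b) - partial b g (x + h *\<^sub>R b)) (at h)"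
      using filterlim_iff[THEN iffD1, OF line, rule_format, OF eventually_conj[OF f(1) g(1)]]
      by eventually_elim (intro DERIV_diff has_real_derivative_along_line; simp)
    show "((\<lambda>h. partial b f (x + h *\<^sub>R b) - partial b g (x + h *\<^sub>R b)) has_real_derivative
        partial b (partial b f) x - partial b (partial b g) x) (at 0)"
      using has_real_derivative_along_line[of "partial b f" x 0 b] f(2)[OF b]
        has_real_derivative_along_line[of "partial b g" x 0 b] g(2)[OF b]
      by (auto intro!: DERIV_diff)
    show "\<forall>\<^sub>F h in nhds 0. f (x + h *\<^sub>R b) - g (x + h *\<^sub>R b) \<le> f (x + 0 *\<^sub>R b) - g (x + 0 *\<^sub>R b)"
      using filterlim_iff[THEN iffD1, OF line, rule_format, OF max] by simp
  qed
  then show "partial b (partial b f) x \<le> partial b (partial b g) x" by simp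
qed

text \<open>The maximum may sit at the right end of the time interval, which is why only earlier times
  are compared.\<close>

lemma deriv_ge_at_left_max:
  fixes u :: "real \<Rightarrow> real"
  assumes "u differentiable (at t)" "0 < t"
    and max: "\<And>s. 0 \<le> s \<Longrightarrow> s \<le> t \<Longrightarrow> u s - \<delta> * s \<le> u t - \<delta> * t"
  shows "\<delta> \<le> deriv u t"
proof (rule ccontr)
  assume "\<not> \<delta> \<le> deriv u t"
  then have neg: "deriv u t - \<delta> < 0" by simp
  have "(u has_real_derivative deriv u t) (at t)"
    using assms(1) by (simp add: DERIV_deriv_iff_real_differentiable)
  then have "((\<lambda>s. u s - \<delta> * s) has_real_derivative deriv u t - \<delta>) (at t)"
    by (auto intro!: derivative_eq_intros)
  then obtain d where "0 < d" and d: "\<And>h. 0 < h \<Longrightarrow> h < d \<Longrightarrow> u t - \<delta> * t < u (t - h) - \<delta> * (t - h)"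
    using DERIV_neg_dec_left[OF _ neg] by blast
  have "u t - \<delta> * t < u (t - min d t / 2) - \<delta> * (t - min d t / 2)"
    using \<open>0 < d\<close> \<open>0 < t\<close> by (intro d) (auto simp: min_def)
  moreover have "0 \<le> t - min d t / 2" "t - min d t / 2 \<le> t"
    using \<open>0 < d\<close> \<open>0 < t\<close> by (auto simp: min_def)
  ultimately show False
    using max[of "t - min d t / 2"] by simp
qed

text \<open>Because \<open>V\<close> blows up at the boundary of \<open>B\<close> while \<open>u\<close> stays bounded there, \<open>u - V - \<delta> t\<close> can be
  positive only on a compact subset of \<open>B\<close>, and so its positive maximum, if there is one, is attained
  inside. There \<open>u\<^sub>t \<ge> \<delta>\<close>, whereas the second derivative test, the supersolution inequality and
  \<open>u \<ge> V\<close> give \<open>u\<^sub>t \<le> a \<Delta>V - \<alpha> u\<^sup>p \<le> 0\<close>.\<close>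

lemma comparison_with_blowup_supersolution:
  fixes V :: "'a::euclidean_space \<Rightarrow> real"
  assumes u: "classical_solution (\<lambda>f x. a x * laplacian f x) (\<lambda>_. 0) \<alpha> p f u"
    and a: "\<And>x. 0 \<le> a x" and \<alpha>: "\<And>x. 0 \<le> \<alpha> x" and p: "0 \<le> p"
    and B: "open B" "bounded B"
    and V: "\<And>x. x \<in> B \<Longrightarrow> 0 \<le> V x"
    and dV: "\<And>x. x \<in> B \<Longrightarrow> V differentiable (at x)"
      "\<And>x b. x \<in> B \<Longrightarrow> b \<in> Basis \<Longrightarrow> partial b V differentiable (at x)"
    and super: "\<And>x. x \<in> B \<Longrightarrow> a x * laplacian V x \<le> \<alpha> x * V x powr p"
    and blowup: "\<And>M. \<exists>K. compact K \<and> K \<subseteq> B \<and> (\<forall>x\<in>B - K. M \<le> V x)"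
    and initial: "\<And>x. x \<in> B \<Longrightarrow> f x \<le> V x"
    and x: "x \<in> B" and t: "0 \<le> t"
  shows "u x t \<le> V x"
proof (rule ccontr)
  assume "\<not> u x t \<le> V x"
  then have gt: "V x < u x t" by simp
  have u_cont: "continuous_on (UNIV \<times> {0..}) (\<lambda>(x, t). u x t)"
    and u_C2: "\<And>t. 0 < t \<Longrightarrow> C2_fun (\<lambda>x. u x t)"
    and u_diff: "\<And>x t. 0 < t \<Longrightarrow> u x differentiable (at t)"
    and u_eq: "\<And>x t. 0 < t \<Longrightarrow> deriv (u x) t = a x * laplacian (\<lambda>y. u y t) x - \<alpha> x * u x t powr p"
    and u_0: "\<And>x. u x 0 = f x" and u_nonneg: "\<And>x t. 0 \<le> t \<Longrightarrow> 0 \<le> u x t"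
    using u by (auto simp: classical_solution_def)
  have "t \<noteq> 0"
    using gt initial[OF x] u_0 by auto
  with t have "0 < t" by simp
  have "bounded ((\<lambda>(x, t). u x t) ` (closure B \<times> {0..t}))"
    using B(2) by (intro compact_imp_bounded compact_continuous_image compact_Times
        continuous_on_subset[OF u_cont]) auto
  then obtain M where "\<forall>z\<in>(\<lambda>(x, t). u x t) ` (closure B \<times> {0..t}). norm z \<le> M"
    by (auto simp: bounded_iff)
  then have M: "u y s \<le> M" if "y \<in> B" "0 \<le> s" "s \<le> t" for y s
    using that closure_subset[of B] by (force simp: image_iff)
  obtain K where K: "compact K" "K \<subseteq> B" and KV: "\<And>y. y \<in> B - K \<Longrightarrow> M \<le> V y"
    using blowup[of M] by blast
  \<comment> \<open>Half of the excess at \<open>(x, t)\<close> is spent, so that \<open>W x t\<close> remains positive.\<close>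
  define \<delta> where "\<delta> = (u x t - V x) / (2 * t)"
  have "0 < \<delta>"
    using gt \<open>0 < t\<close> by (simp add: \<delta>_def)
  define W where "W y s = u y s - V y - \<delta> * s" for y s
  have W_x: "0 < W x t"
    using gt \<open>0 < t\<close> by (simp add: W_def \<delta>_def field_simps)
  have "x \<in> K"
  proof (rule ccontr)
    assume "x \<notin> K"
    then have "u x t \<le> V x"
      using M[OF x t] KV[of x] x by force
    then show False using gt by simp
  qed
  have "continuous_on K V"
    using dV(1) K(2) by (intro continuous_at_imp_continuous_on ballI differentiable_imp_continuous_within) auto
  then have "continuous_on (K \<times> {0..t}) (\<lambda>z. V (fst z))"
    by (rule continuous_on_compose2) (auto intro: continuous_intros)
  moreover have "continuous_on (K \<times> {0..t}) (\<lambda>z. u (fst z) (snd z))"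
    by (rule continuous_on_subset[OF u_cont[unfolded case_prod_unfold]]) auto
  ultimately have W_cont: "continuous_on (K \<times> {0..t}) (\<lambda>z. W (fst z) (snd z))"
    unfolding W_def by (intro continuous_intros)
  have "compact (K \<times> {0..t})" "K \<times> {0..t} \<noteq> {}"
    using K \<open>x \<in> K\<close> t by (auto intro: compact_Times)
  from continuous_attains_sup[OF this W_cont] obtain z where z: "z \<in> K \<times> {0..t}" "\<And>z'. z' \<in> K \<times> {0..t} \<Longrightarrow> W (fst z') (snd z') \<le> W (fst z) (snd z)"
    by blast
  obtain y s where ys: "z = (y, s)" by (cases z)
  have y: "y \<in> K" "y \<in> B" and s: "0 \<le> s" "s \<le> t"
    using z(1) K(2) by (auto simp: ys)
  have W_max: "W y' s' \<le> W y s" if "y' \<in> K" "0 \<le> s'" "s' \<le> t" for y' s'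
    using z(2)[of "(y', s')"] that by (simp add: ys)
  have W_pos: "0 < W y s"
    using W_max[OF \<open>x \<in> K\<close> t] W_x by simp
  have "s \<noteq> 0"
    using W_pos initial[OF y(2)] u_0 by (auto simp: W_def)
  with s have "0 < s" by simp
  have W_max': "W y' s \<le> W y s" if "y' \<in> B" for y'
  proof (cases "y' \<in> K")
    case False
    have "0 \<le> \<delta> * s" using \<open>0 < \<delta>\<close> s by simp
    then have "W y' s \<le> 0"
      using M[OF that s] KV[of y'] that False by (simp add: W_def)
    then show ?thesis using W_pos by simp
  qed (use W_max s in auto)
  have near_B: "\<forall>\<^sub>F y' in nhds y. y' \<in> B"
    using B(1) y(2) by (rule eventually_nhds_in_open)
  have "laplacian (\<lambda>y. u y s) y \<le> laplacian V y"
  proof (rule laplacian_le_at_local_max)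
    show "\<forall>\<^sub>F y' in nhds y. V differentiable (at y')"
      using near_B by eventually_elim (rule dV)
    show "\<forall>\<^sub>F y' in nhds y. u y' s - V y' \<le> u y s - V y"
      using near_B by eventually_elim (use W_max' in \<open>auto simp: W_def\<close>)
  qed (use u_C2[OF \<open>0 < s\<close>] dV(2)[OF y(2)] in \<open>auto simp: C2_fun_def C1_fun_def\<close>)
  then have "a y * laplacian (\<lambda>y. u y s) y \<le> a y * laplacian V y"
    using a by (rule mult_left_mono)
  also have "\<dots> \<le> \<alpha> y * V y powr p"
    using super[OF y(2)] .
  also have "\<dots> \<le> \<alpha> y * u y s powr p"
  proof (intro mult_left_mono powr_mono2 \<alpha> p V y)
    have "0 \<le> \<delta> * s" using \<open>0 < \<delta>\<close> s by simp
    then show "V y \<le> u y s" using W_pos by (simp add: W_def)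
  qed
  finally have "deriv (u y) s \<le> 0"
    by (simp add: u_eq[OF \<open>0 < s\<close>])
  moreover have "\<delta> \<le> deriv (u y) s"
  proof (rule deriv_ge_at_left_max[OF u_diff[OF \<open>0 < s\<close>] \<open>0 < s\<close>])
    fix s' assume "0 \<le> s'" "s' \<le> s"
    then show "u y s' - \<delta> * s' \<le> u y s - \<delta> * s"
      using W_max[OF y(1), of s'] s by (simp add: W_def)
  qed
  ultimately show False
    using \<open>0 < \<delta>\<close> by simp
qed

section \<open>From barriers to the compact support property\<close>

lemma exp_neg_ge:
  assumes "z \<le> ennreal e" "0 \<le> e"
  shows "exp (- e) \<le> exp_neg z"
proof -
  have "z \<noteq> \<infinity>" using assms(1) by (auto simp: top_unique)
  then show ?thesis
    using assms by (auto simp: exp_neg_def intro!: enn2real_leI)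
qed

text \<open>The complement of the support is a union of open null sets, and countably many of them suffice
  by the Lindeloef property.\<close>

lemma null_outside_support:
  fixes \<mu> :: "'a::euclidean_space measure"
  assumes "sets \<mu> = sets borel"
  shows "AE x in \<mu>. x \<in> measure_support \<mu>"
proof -
  define F where "F = {U. open U \<and> emeasure \<mu> U = 0}"
  obtain F' where F': "F' \<subseteq> F" "countable F'" "\<Union>F' = \<Union>F"
    using Lindelof[of F] by (auto simp: F_def)
  have "(\<Union>U\<in>F'. U) \<in> null_sets \<mu>"
    using F' assms by (intro null_sets_UN') (auto simp: F_def null_sets_def)
  moreover have "{x \<in> space \<mu>. x \<notin> measure_support \<mu>} \<subseteq> (\<Union>U\<in>F'. U)"
    using F'(3) by (force simp: measure_support_def F_def)
  ultimately show ?thesis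
    by (rule AE_I')
qed

context measure_valued_diffusion
begin

text \<open>Weak right-continuity tested against a function that is positive exactly outside the ball: its
  integral vanishes at rational times and therefore at all times.\<close>

lemma support_bound_all_times:
  assumes \<omega>: "\<omega> \<in> space \<Omega>" and t: "0 \<le> t"
    and null: "\<And>s. s \<in> \<rat> \<Longrightarrow> 0 \<le> s \<Longrightarrow> emeasure (X s \<omega>) {x. R < norm x} = 0"
  shows "measure_support (X t \<omega>) \<subseteq> cball 0 R"
proof -
  \<comment> \<open>Bounded and continuous, and positive exactly where \<open>R < norm x\<close>.\<close>
  define g :: "'a \<Rightarrow> real" where "g x = min 1 (max 0 (norm x - R))" for x
  have g: "continuous_on UNIV g" "bounded (range g)" "\<And>x. 0 \<le> g x" "\<And>x. g x = 0 \<longleftrightarrow> \<not> R < norm x"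
    unfolding g_def by (auto intro!: continuous_intros boundedI[where B = 1])
  have mble: "g \<in> borel_measurable (X s \<omega>)" "{x. R < norm x} \<in> sets (X s \<omega>)" if "0 \<le> s" for s
  proof -
    have "sets (X s \<omega>) = sets borel"
      using state_finite[OF that \<omega>] by (simp add: finite_measures_def)
    moreover have "{x :: 'a. R < norm x} \<in> sets borel"
      by (intro borel_open open_Collect_less continuous_intros)
    ultimately show "g \<in> borel_measurable (X s \<omega>)" "{x. R < norm x} \<in> sets (X s \<omega>)"
      using borel_measurable_continuous_onI[OF g(1)] by (simp_all cong: measurable_cong_sets)
  qed
  have zero: "(\<integral>x. g x \<partial>X s \<omega>) = 0" if s: "s \<in> \<rat>" "0 \<le> s" for s
  proof -
    have "{x. R < norm x} \<in> null_sets (X s \<omega>)"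
      using mble[OF s(2)] null[OF s] by (simp add: null_sets_def)
    then have "AE x in X s \<omega>. \<not> R < norm x"
      by (rule AE_I') auto
    then have "AE x in X s \<omega>. g x = 0"
      using g(4) by auto
    then show ?thesis
      by (rule integral_eq_zero_AE)
  qed
  have lim: "((\<lambda>s. \<integral>x. g x \<partial>X s \<omega>) \<longlongrightarrow> (\<integral>x. g x \<partial>X t \<omega>)) (at_right t)"
    using right_continuous[OF \<omega> t] g(1,2) by (simp add: weakly_tends_def)
  have "(\<integral>x. g x \<partial>X t \<omega>) = 0"
  proof (rule ccontr)
    assume "(\<integral>x. g x \<partial>X t \<omega>) \<noteq> 0"
    then have "\<forall>\<^sub>F s in at_right t. (\<integral>x. g x \<partial>X s \<omega>) \<noteq> 0"
      by (rule tendsto_imp_eventually_ne[OF lim])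
    then obtain b where "t < b" and b: "\<And>s. t < s \<Longrightarrow> s < b \<Longrightarrow> (\<integral>x. g x \<partial>X s \<omega>) \<noteq> 0"
      by (auto simp: eventually_at_right_field)
    obtain r where "r \<in> \<rat>" "t < r" "r < b"
      using Rats_dense_in_real[OF \<open>t < b\<close>] by blast
    then show False
      using b[of r] zero[of r] t by simp
  qed
  moreover interpret finite_measure "X t \<omega>"
    using state_finite[OF t \<omega>] by (simp add: finite_measures_def)
  have "integrable (X t \<omega>) g"
    using mble[OF t] g(3) by (intro integrable_const_bound[where B = 1]) (auto simp: g_def)
  ultimately have "AE x in X t \<omega>. g x = 0"
    using g(3) by (simp add: integral_nonneg_eq_0_iff_AE)
  then have "AE x in X t \<omega>. x \<notin> {x. R < norm x}"
    using g(4) by auto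
  then have "emeasure (X t \<omega>) {x. R < norm x} = 0"
    using AE_iff_null_sets[OF mble(2)[OF t]] by auto
  moreover have "open {x :: 'a. R < norm x}"
    by (intro open_Collect_less continuous_intros)
  ultimately show ?thesis
    by (force simp: measure_support_def)
qed

text \<open>With probability at least \<open>exp (- \<langle>U n, \<mu>\<rangle>)\<close> the process never leaves the bounded set where
  \<open>U n\<close> is finite. If the barriers can be taken arbitrarily small on the support of \<open>\<mu>\<close>, then almost
  every path is confined by one of them. The barriers being stationary, the bound holds for all
  times at once.\<close>

lemma compact_support_from_barriers:
  fixes U :: "nat \<Rightarrow> 'a \<Rightarrow> ennreal"
  assumes U: "\<And>n. barrier L \<beta> \<alpha> p (U n)" "\<And>n. approximable_from_below (U n)"
    and bdd: "\<And>n. bounded {x. U n x < \<infinity>}"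
    and small: "\<And>K e. compact K \<Longrightarrow> 0 < e \<Longrightarrow> \<exists>n. \<forall>x\<in>K. U n x \<le> ennreal e"
  shows "compact_support_property P X"
  unfolding compact_support_property_def
proof (intro ballI impI allI)
  fix \<mu> :: "'a measure" and t :: real
  assume \<mu>: "\<mu> \<in> finite_measures" and supp: "compact (measure_support \<mu>)" and t: "0 \<le> t"
  interpret prob_space "P \<mu>" using prob_space_P[OF \<mu>] .
  interpret M: finite_measure \<mu> using \<mu> by (simp add: finite_measures_def)
  define T :: "real set" where "T = \<rat> \<inter> {0..}"
  have T: "countable T" "T \<subseteq> {0..}"
    by (auto simp: T_def countable_rat)
  define S where "S n = {\<omega> \<in> space (P \<mu>). \<forall>s\<in>T. barrier_functional (U n) (X s \<omega>) \<noteq> 0}" for n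
  have S: "S n \<in> events" "ennreal (barrier_functional (U n) \<mu>) \<le> emeasure (P \<mu>) (S n)" for n
    using barrier_functional_survival_countable[OF U \<mu> T] by (simp_all add: S_def)
  have "exp (- e) \<le> prob (\<Union>n. S n)" if "0 < e" for e
  proof -
    define c where "c = measure \<mu> (space \<mu>)"
    have "0 \<le> c" by (simp add: c_def)
    then have "0 < e / (c + 1)" using that by simp
    from small[OF supp this] obtain n where n: "\<And>x. x \<in> measure_support \<mu> \<Longrightarrow> U n x \<le> ennreal (e / (c + 1))"
      by blast
    have "(\<integral>\<^sup>+ x. U n x \<partial>\<mu>) \<le> (\<integral>\<^sup>+ x. ennreal (e / (c + 1)) \<partial>\<mu>)"
      using null_outside_support[of \<mu>] \<mu> n
      by (intro nn_integral_mono_AE) (auto simp: finite_measures_def elim: eventually_mono)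
    also have "\<dots> = ennreal (e / (c + 1) * c)"
      using \<open>0 < e / (c + 1)\<close> by (simp add: M.emeasure_eq_measure c_def ennreal_mult'[symmetric])
    also have "\<dots> \<le> ennreal e"
      using \<open>0 \<le> c\<close> that by (intro ennreal_leI) (simp add: field_simps)
    finally have "exp (- e) \<le> barrier_functional (U n) \<mu>"
      unfolding barrier_functional_def using that by (intro exp_neg_ge) auto
    also have "\<dots> \<le> prob (S n)"
      using S(2)[of n] by (simp add: emeasure_eq_measure)
    also have "\<dots> \<le> prob (\<Union>n. S n)"
      using S(1) by (intro finite_measure_mono) auto
    finally show ?thesis .
  qed
  then have "\<And>k. exp (- inverse (real (Suc k))) \<le> prob (\<Union>n. S n)"
    by simp
  moreover have "(\<lambda>k. exp (- inverse (real (Suc k)))) \<longlonglongrightarrow> exp (- 0)"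
    by (intro tendsto_intros LIMSEQ_inverse_real_of_nat)
  ultimately have "1 \<le> prob (\<Union>n. S n)"
    by (intro LIMSEQ_le_const2) auto
  then have "prob (\<Union>n. S n) = 1"
    using prob_le_1 by (intro antisym)
  then have "AE \<omega> in P \<mu>. \<omega> \<in> (\<Union>n. S n)"
    using S(1) by (subst (asm) prob_eq_1) auto
  then show "AE \<omega> in P \<mu>. bounded (\<Union>s\<in>{0..t}. measure_support (X s \<omega>))"
  proof eventually_elim
    case (elim \<omega>)
    then obtain n where n: "\<omega> \<in> S n" by blast
    then have \<omega>: "\<omega> \<in> space \<Omega>" by (simp add: S_def space_P[OF \<mu>])
    obtain R where R: "\<And>x. U n x < \<infinity> \<Longrightarrow> norm x \<le> R"
      using bdd[of n] by (auto simp: bounded_iff)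
    have "emeasure (X s \<omega>) {x. R < norm x} = 0" if s: "s \<in> \<rat>" "0 \<le> s" for s
    proof -
      have sets: "sets (X s \<omega>) = sets borel"
        using state_finite[OF s(2) \<omega>] by (simp add: finite_measures_def)
      have Um: "U n \<in> borel_measurable (X s \<omega>)"
        using measurable_approximable[OF U(2)] sets by (simp cong: measurable_cong_sets)
      have "barrier_functional (U n) (X s \<omega>) \<noteq> 0"
        using n s by (simp add: S_def T_def)
      then have "(\<integral>\<^sup>+ x. U n x \<partial>X s \<omega>) \<noteq> \<infinity>"
        by (auto simp: barrier_functional_def exp_neg_def)
      then have "emeasure (X s \<omega>) (U n -` {\<infinity>} \<inter> space (X s \<omega>)) = 0"
        by (rule nn_integral_PInf[OF Um])
      moreover have "U n x = \<infinity>" if "R < norm x" for x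
        using R[of x] that by (cases "U n x = \<infinity>") (auto simp: less_top)
      then have "{x. R < norm x} \<subseteq> U n -` {\<infinity>} \<inter> space (X s \<omega>)"
        using sets_eq_imp_space_eq[OF sets] by auto
      moreover have "U n -` {\<infinity>} \<inter> space (X s \<omega>) \<in> sets (X s \<omega>)"
        using Um by measurable
      ultimately show ?thesis
        using emeasure_mono[of "{x. R < norm x}"] by (metis le_zero_eq)
    qed
    then have "measure_support (X s \<omega>) \<subseteq> cball 0 R" if "s \<in> {0..t}" for s
      using support_bound_all_times[OF \<omega>] that by auto
    then show ?case
      by (intro bounded_subset[OF bounded_cball[of 0 R]]) blast
  qed
qed

end

section \<open>The logarithmic barrier\<close>

text \<open>The barrier on the ball \<open>ln (1 + |x|\<^sup>2) < S\<close>. The logarithm is forced by scaling: for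
  \<open>\<alpha> x / (1 + |x|) powr m = (1 + |x|) powr (- 2)\<close> the equation \<open>\<Delta>V = (1 + |x|) powr (- 2) * V powr p\<close>
  becomes, for radial \<open>V\<close> and large \<open>|x|\<close>, an ordinary differential equation in \<open>s = ln (1 + |x|\<^sup>2)\<close>
  with constant coefficients, and \<open>(S - s) powr (- 2 / (p - 1))\<close> is its blow-up profile. A barrier
  that depended on \<open>|x| / R\<close> alone would not become small at the origin as \<open>R\<close> grows.\<close>

definition log_barrier :: "real \<Rightarrow> real \<Rightarrow> real \<Rightarrow> 'a::euclidean_space \<Rightarrow> ennreal" where
  "log_barrier A \<gamma> S x =
     (if ln (1 + x \<bullet> x) < S then ennreal (A * (S - ln (1 + x \<bullet> x)) powr (- \<gamma>)) else \<infinity>)"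

lemma one_plus_inner_pos: "0 < 1 + x \<bullet> (x :: 'a::real_inner)"
  by (intro add_pos_nonneg) auto

lemma continuous_on_ln_one_plus_inner:
  "continuous_on UNIV (\<lambda>x. ln (1 + x \<bullet> (x :: 'a::real_inner)))"
  by (intro continuous_intros ballI order.strict_implies_not_eq[THEN not_sym] one_plus_inner_pos)

lemma bounded_log_barrier: "bounded {x :: 'a::euclidean_space. log_barrier A \<gamma> S x < \<infinity>}"
proof (rule boundedI)
  fix x :: 'a assume "x \<in> {x. log_barrier A \<gamma> S x < \<infinity>}"
  then have "ln (1 + x \<bullet> x) < S"
    by (auto simp: log_barrier_def split: if_splits)
  then have "1 + x \<bullet> x < exp S"
    using one_plus_inner_pos[of x] by (metis exp_less_cancel_iff exp_ln)
  then have "(norm x)\<^sup>2 \<le> exp S"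
    by (simp add: power2_norm_eq_inner)
  then show "norm x \<le> sqrt (exp S)"
    by (rule real_le_rsqrt)
qed

text \<open>The approximations cut off the singularity by keeping \<open>S - ln (1 + |x|\<^sup>2)\<close> above \<open>1 / (k + 1)\<close>, and
  cut off the values near infinity by a continuous function that is \<open>1\<close> on the ball of radius \<open>k - 1\<close>
  and \<open>0\<close> outside the ball of radius \<open>k\<close>.\<close>

lemma approximable_log_barrier:
  assumes A: "0 < A" and \<gamma>: "0 < \<gamma>"
  shows "approximable_from_below (log_barrier A \<gamma> S :: 'a::euclidean_space \<Rightarrow> ennreal)"
  unfolding approximable_from_below_def
proof (intro exI conjI allI)
  define v where "v x = S - ln (1 + x \<bullet> x)" for x :: 'a
  define w where "w k x = max (v x) (1 / real (Suc k))" for k x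
  define cut where "cut k x = max 0 (min 1 (real k - norm x))" for k and x :: 'a
  define f where "f k x = cut k x * (A * w k x powr (- \<gamma>))" for k x
  have w_pos: "0 < w k x" for k x
    by (simp add: w_def less_max_iff_disj)
  show "continuous_on UNIV (f k)" for k
    unfolding f_def
  proof (intro continuous_intros ballI)
    show "continuous_on UNIV (w k)"
      unfolding w_def v_def by (intro continuous_intros continuous_on_ln_one_plus_inner)
    show "continuous_on UNIV (cut k)"
      unfolding cut_def by (intro continuous_intros)
    show "w k x \<noteq> 0" for x using w_pos[of k x] by simp
  qed
  show nonneg: "0 \<le> f k x" for k x
    using A by (simp add: f_def cut_def)
  show "compact (closure {x. f k x \<noteq> 0})" for k
  proof -
    have "{x. f k x \<noteq> 0} \<subseteq> cball 0 (real k)"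
      by (auto simp: f_def cut_def)
    then have "bounded {x. f k x \<noteq> 0}"
      by (rule bounded_subset[OF bounded_cball])
    then show ?thesis by simp
  qed
  show inc: "incseq (\<lambda>k. f k x)" for x
  proof (rule incseq_SucI)
    fix k
    have "w (Suc k) x \<le> w k x"
      unfolding w_def by (intro max.mono) (auto simp: divide_simps)
    then have "w k x powr (- \<gamma>) \<le> w (Suc k) x powr (- \<gamma>)"
      using w_pos \<gamma> by (intro powr_mono2') auto
    then show "f k x \<le> f (Suc k) x"
      unfolding f_def using A by (intro mult_mono) (auto simp: cut_def)
  qed
  show "log_barrier A \<gamma> S x = (SUP k. ennreal (f k x))" for x
  proof -
    have far: "\<forall>\<^sub>F k in sequentially. norm x + 1 \<le> real k"
      by real_asymp
    have "(\<lambda>k. ennreal (f k x)) \<longlonglongrightarrow> log_barrier A \<gamma> S x"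
    proof (cases "0 < v x")
      case True
      have "\<forall>\<^sub>F k in sequentially. cut k x = 1"
        using far by eventually_elim (simp add: cut_def)
      moreover have "\<forall>\<^sub>F k in sequentially. 1 / real (Suc k) < v x"
        using order_tendstoD(2)[OF LIMSEQ_inverse_real_of_nat True] by (simp add: inverse_eq_divide)
      ultimately have "\<forall>\<^sub>F k in sequentially. ennreal (f k x) = log_barrier A \<gamma> S x"
        by eventually_elim (use True in \<open>auto simp: f_def w_def v_def log_barrier_def max_def\<close>)
      then show ?thesis
        by (rule tendsto_eventually)
    next
      case False
      have w_eq: "w k x = 1 / real (Suc k)" for k
      proof -
        have "v x \<le> 0" using False by simp
        also have "0 \<le> 1 / real (Suc k)" by simp
        finally show ?thesis unfolding w_def by (rule max_absorb2)
      qed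
      have "\<forall>\<^sub>F k in sequentially. cut k x = 1"
        using far by eventually_elim (simp add: cut_def)
      then have ev: "\<forall>\<^sub>F k in sequentially. A * (1 / real (Suc k)) powr (- \<gamma>) = f k x"
        by eventually_elim (simp add: f_def w_eq)
      have "filterlim (\<lambda>k. A * (1 / real (Suc k)) powr (- \<gamma>)) at_top sequentially"
        using A \<gamma> by real_asymp
      then have "filterlim (\<lambda>k. f k x) at_top sequentially"
        using filterlim_cong[OF refl refl ev] by blast
      then show ?thesis
        using False by (simp add: ennreal_tendsto_top_eq_at_top log_barrier_def v_def)
    qed
    moreover have "(\<lambda>k. ennreal (f k x)) \<longlonglongrightarrow> (SUP k. ennreal (f k x))"
      using inc[of x] by (intro LIMSEQ_SUP) (auto simp: incseq_def intro!: ennreal_leI)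
    ultimately show ?thesis
      by (rule LIMSEQ_unique)
  qed
qed

text \<open>For \<open>\<gamma> = 2 / (p - 1)\<close> the power \<open>p - 1\<close> of this constant is \<open>\<gamma> * (8 * (\<gamma> + 1) + 4 * d * S)\<close>. The two
  summands pay for the second-order and the first-order part of the Laplacian in the variable
  \<open>ln (1 + |x|\<^sup>2)\<close>; the factor \<open>S\<close> in the latter is the largest value of \<open>S - ln (1 + |x|\<^sup>2)\<close>.\<close>

definition log_barrier_const :: "real \<Rightarrow> real \<Rightarrow> real \<Rightarrow> real" where
  "log_barrier_const d \<gamma> S = (\<gamma> * (8 * (\<gamma> + 1) + 4 * d * S)) powr (\<gamma> / 2)"

text \<open>With \<open>v = S - ln (1 + |x|\<^sup>2)\<close> and \<open>V = A * v powr (- \<gamma>)\<close> one computes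
  \<open>\<Delta>V \<le> A * \<gamma> * v powr (- \<gamma> - 2) * (4 * (\<gamma> + 1) + 2 * d * v) / (1 + |x|\<^sup>2)\<close>. As \<open>\<gamma> * p = \<gamma> + 2\<close>, the power
  \<open>V powr p\<close> carries the same factor \<open>v powr (- \<gamma> - 2)\<close>, and \<open>A\<close> is large enough to absorb the rest,
  using \<open>v \<le> S\<close> and \<open>(1 + |x|)\<^sup>2 \<le> 2 * (1 + |x|\<^sup>2)\<close>.\<close>

lemma barrier_log_barrier:
  fixes S p m :: real
  assumes "1 < p" "0 < S"
  defines "\<gamma> \<equiv> 2 / (p - 1)"
  defines "A \<equiv> log_barrier_const DIM('a) \<gamma> S"
  shows "barrier (weighted_laplacian m) (\<lambda>_. 0) (\<lambda>x. (1 + norm x) powr (m - 2)) p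
    (log_barrier A \<gamma> S :: 'a::euclidean_space \<Rightarrow> ennreal)"
  unfolding barrier_def
proof (intro allI impI, elim conjE)
  fix f :: "'a \<Rightarrow> real" and u x and t :: real
  assume u: "classical_solution (weighted_laplacian m) (\<lambda>_. 0) (\<lambda>x. (1 + norm x) powr (m - 2)) p f u"
    and f: "\<forall>x. ennreal (f x) \<le> log_barrier A \<gamma> S x" and t: "0 \<le> t"
  have \<gamma>: "0 < \<gamma>" using assms by simp
  define D where "D = 4 * (\<gamma> + 1) + 2 * DIM('a) * S"
  have D: "0 < D" unfolding D_def using \<gamma> assms(2) by (intro add_pos_nonneg) auto
  have A_eq: "A = (2 * \<gamma> * D) powr (\<gamma> / 2)"
    by (simp add: A_def log_barrier_const_def D_def algebra_simps)
  have A: "0 < A" using D \<gamma> by (simp add: A_eq)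
  have A_p: "A powr p = A * (2 * \<gamma> * D)"
  proof -
    have "A powr p = A powr 1 * A powr (p - 1)"
      unfolding powr_add[symmetric] by simp
    also have "A powr (p - 1) = (2 * \<gamma> * D) powr (\<gamma> / 2 * (p - 1))"
      by (simp only: A_eq powr_powr)
    also have "\<gamma> / 2 * (p - 1) = 1"
      using assms(1) by (simp add: \<gamma>_def)
    also have "(2 * \<gamma> * D) powr 1 = 2 * \<gamma> * D"
      using \<gamma> D by simp
    finally show ?thesis using A by simp
  qed
  define V where "V x = A * (S - ln (1 + x \<bullet> x)) powr (- \<gamma>)" for x :: 'a
  define B where "B = {x :: 'a. ln (1 + x \<bullet> x) < S}"
  define I where "I = {-1<..<exp S - 1}"
  define v where "v \<rho> = S - ln (1 + \<rho>)" for \<rho>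
  define G where "G \<rho> = A * v \<rho> powr (- \<gamma>)" for \<rho>
  define G' where "G' \<rho> = A * \<gamma> * v \<rho> powr (- \<gamma> - 1) / (1 + \<rho>)" for \<rho>
  define G'' where "G'' \<rho> = A * \<gamma> * ((\<gamma> + 1) * v \<rho> powr (- \<gamma> - 2) - v \<rho> powr (- \<gamma> - 1)) / (1 + \<rho>)\<^sup>2" for \<rho>
  have I: "open I" by (simp add: I_def)
  have B_I: "x \<bullet> x \<in> I \<longleftrightarrow> x \<in> B" for x
  proof -
    have "ln (1 + x \<bullet> x) < S \<longleftrightarrow> 1 + x \<bullet> x < exp S"
      using one_plus_inner_pos[of x] by (metis exp_less_cancel_iff exp_ln)
    moreover have "- 1 < x \<bullet> x" by (rule less_le_trans[of _ 0]) auto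
    ultimately show ?thesis by (auto simp: I_def B_def)
  qed
  have v: "0 < v \<rho>" "0 < 1 + \<rho>" if "\<rho> \<in> I" for \<rho>
  proof -
    show "0 < 1 + \<rho>" using that by (simp add: I_def)
    then have "ln (1 + \<rho>) < ln (exp S)"
      using that by (subst ln_less_cancel_iff) (auto simp: I_def)
    then show "0 < v \<rho>" by (simp add: v_def)
  qed
  have dv: "(v has_real_derivative - 1 / (1 + \<rho>)) (at \<rho>)" if "\<rho> \<in> I" for \<rho>
    unfolding v_def using v(2)[OF that] by (auto intro!: derivative_eq_intros)
  have dpow: "((\<lambda>\<rho>. v \<rho> powr e) has_real_derivative - e * v \<rho> powr (e - 1) / (1 + \<rho>)) (at \<rho>)"
    if "\<rho> \<in> I" for \<rho> e
    using DERIV_powr[OF dv[OF that] v(1)[OF that] DERIV_const] v[OF that]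
    by (simp add: powr_diff field_simps)
  have dG: "(G has_real_derivative G' \<rho>) (at \<rho>)" if "\<rho> \<in> I" for \<rho>
    unfolding G_def G'_def
    by (rule derivative_eq_intros dpow that refl)+ simp
  have dG': "(G' has_real_derivative G'' \<rho>) (at \<rho>)" if "\<rho> \<in> I" for \<rho>
  proof -
    have "((\<lambda>\<rho>. v \<rho> powr (- \<gamma> - 1)) has_real_derivative (\<gamma> + 1) * v \<rho> powr (- \<gamma> - 2) / (1 + \<rho>)) (at \<rho>)"
      using dpow[OF that, of "- \<gamma> - 1"] by (simp add: algebra_simps)
    moreover have "((\<lambda>\<rho>. 1 + \<rho>) has_real_derivative 1) (at \<rho>)"
      by (auto intro!: derivative_eq_intros)
    ultimately have "(G' has_real_derivative
        (A * \<gamma> * ((\<gamma> + 1) * v \<rho> powr (- \<gamma> - 2) / (1 + \<rho>)) * (1 + \<rho>) - A * \<gamma> * v \<rho> powr (- \<gamma> - 1) * 1)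
          / ((1 + \<rho>) * (1 + \<rho>))) (at \<rho>)"
      unfolding G'_def using v(2)[OF that] by (intro DERIV_divide DERIV_cmult) auto
    then show ?thesis
      by (rule DERIV_cong) (use v(2)[OF that] in \<open>simp add: G''_def power2_eq_square right_diff_distrib\<close>)
  qed
  have V_G: "V = (\<lambda>x. G (x \<bullet> x))" by (simp add: V_def G_def v_def fun_eq_iff)
  have u_le: "u x t \<le> V x" if "x \<in> B"
  proof (rule comparison_with_blowup_supersolution[where a = "\<lambda>x. (1 + norm x) powr m"
        and \<alpha> = "\<lambda>x. (1 + norm x) powr (m - 2)" and p = p and f = f and B = B
        and u = u and V = V and x = x and t = t])
    show "classical_solution (\<lambda>f x. (1 + norm x) powr m * laplacian f x) (\<lambda>_. 0)
        (\<lambda>x. (1 + norm x) powr (m - 2)) p f u"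
      using u by (simp add: weighted_laplacian_def[abs_def])
    show "open B"
      unfolding B_def by (intro open_Collect_less continuous_intros continuous_on_ln_one_plus_inner)
    show "bounded B"
      by (rule bounded_subset[OF bounded_log_barrier[of A \<gamma> S]]) (auto simp: B_def log_barrier_def)
    show "0 \<le> V x" for x using A by (simp add: V_def)
    show "V differentiable (at x)" if "x \<in> B" for x
      using partial_radial(1)[OF dG] that unfolding V_G differentiable_def B_I[symmetric] by blast
    show "partial b V differentiable (at x)" if "x \<in> B" for x b
      using partial_partial_radial(1)[OF I _ dG dG'] that unfolding V_G B_I[symmetric] by blast
    show "(1 + norm x) powr m * laplacian V x \<le> (1 + norm x) powr (m - 2) * V x powr p" if "x \<in> B" for x
    proof -
      define \<rho> where "\<rho> = x \<bullet> x"
      have \<rho>: "\<rho> \<in> I" "0 \<le> \<rho>" using that B_I by (auto simp: \<rho>_def)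
      define q where "q = v \<rho> powr (- \<gamma> - 2)"
      have q: "0 < q" using v[OF \<rho>(1)] by (simp add: q_def)
      have v1: "v \<rho> powr (- \<gamma> - 1) = q * v \<rho>"
        using v[OF \<rho>(1)] by (simp add: q_def powr_diff power2_eq_square field_simps)
      have vS: "v \<rho> \<le> S" using \<rho>(2) by (simp add: v_def)
      have "laplacian V x = 2 * DIM('a) * G' \<rho> + 4 * \<rho> * G'' \<rho>"
        unfolding V_G \<rho>_def using B_I that by (intro laplacian_radial[OF I _ dG dG']) auto
      also have "2 * DIM('a) * G' \<rho> \<le> A * \<gamma> * q / (1 + \<rho>) * (2 * DIM('a) * S)"
        using vS v[OF \<rho>(1)] A \<gamma> q
        by (simp add: G'_def v1 divide_right_mono mult_left_mono mult.commute mult.left_commute)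
      also have "4 * \<rho> * G'' \<rho> \<le> A * \<gamma> * q / (1 + \<rho>) * (4 * (\<gamma> + 1))"
      proof -
        have "4 * \<rho> * G'' \<rho> = A * \<gamma> * q / (1 + \<rho>) * (4 * (\<rho> / (1 + \<rho>)) * (\<gamma> + 1 - v \<rho>))"
        proof -
          have "G'' \<rho> = A * \<gamma> * (q * (\<gamma> + 1 - v \<rho>)) / ((1 + \<rho>) * (1 + \<rho>))"
            by (simp add: G''_def v1 q_def[symmetric] power2_eq_square algebra_simps)
          then show ?thesis by (simp add: mult_ac)
        qed
        also have "\<dots> \<le> A * \<gamma> * q / (1 + \<rho>) * (4 * (\<gamma> + 1))"
        proof (intro mult_left_mono)
          have "\<rho> / (1 + \<rho>) * (\<gamma> + 1 - v \<rho>) \<le> \<rho> / (1 + \<rho>) * (\<gamma> + 1)"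
            using \<rho>(2) v[OF \<rho>(1)] by (intro mult_left_mono) auto
          also have "\<dots> \<le> 1 * (\<gamma> + 1)"
            using \<rho>(2) \<gamma> by (intro mult_right_mono) auto
          finally show "4 * (\<rho> / (1 + \<rho>)) * (\<gamma> + 1 - v \<rho>) \<le> 4 * (\<gamma> + 1)" by simp
        qed (use A \<gamma> q \<rho>(2) in auto)
        finally show ?thesis .
      qed
      finally have lap: "laplacian V x \<le> A * \<gamma> * q / (1 + \<rho>) * D"
        by (simp add: D_def algebra_simps)
      have Vp: "V x powr p = A * (2 * \<gamma> * D) * q"
      proof -
        have exponent: "- \<gamma> * p = - \<gamma> - 2"
          using assms(1) by (simp add: \<gamma>_def field_simps)
        have "(v \<rho> powr (- \<gamma>)) powr p = v \<rho> powr (- \<gamma> * p)"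
          by (rule powr_powr)
        also have "\<dots> = q"
          unfolding exponent q_def ..
        finally have "(v \<rho> powr (- \<gamma>)) powr p = q" .
        then show ?thesis
          using A by (simp add: V_G G_def \<rho>_def[symmetric] powr_mult A_p)
      qed
      have sq: "(1 + norm x)\<^sup>2 \<le> 2 * (1 + \<rho>)"
        using sum_squares_bound[of 1 "norm x"] 
        by (simp add: \<rho>_def power2_eq_square algebra_simps flip: power2_norm_eq_inner)
      have "(1 + norm x)\<^sup>2 * laplacian V x \<le> (1 + norm x)\<^sup>2 * (A * \<gamma> * q / (1 + \<rho>) * D)"
        using lap by (intro mult_left_mono) auto
      also have "\<dots> \<le> 2 * (1 + \<rho>) * (A * \<gamma> * q / (1 + \<rho>) * D)"
        using sq A \<gamma> q D \<rho>(2) by (intro mult_right_mono) auto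
      also have "\<dots> = V x powr p"
        using \<rho>(2) by (simp add: Vp field_simps)
      finally have *: "(1 + norm x)\<^sup>2 * laplacian V x \<le> V x powr p" .
      have "(1 + norm x) powr m = (1 + norm x) powr (m - 2) * (1 + norm x)\<^sup>2"
        using powr_add[of "1 + norm x" "m - 2" 2] by (simp add: add_nonneg_pos add.commute)
      then show ?thesis
        using mult_left_mono[OF *, of "(1 + norm x) powr (m - 2)"] by (simp add: mult.assoc)
    qed
    show "\<exists>K. compact K \<and> K \<subseteq> B \<and> (\<forall>x\<in>B - K. M \<le> V x)" for M
    proof -
      define M' where "M' = max M 1"
      \<comment> \<open>The solution of \<open>A * e powr (- \<gamma>) = M'\<close>.\<close>
      define e where "e = (M' / A) powr (- 1 / \<gamma>)"
      have e: "0 < e" using A by (simp add: e_def M'_def)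
      have eM: "A * e powr (- \<gamma>) = M'"
        using A \<gamma> by (simp add: e_def powr_powr M'_def)
      define K where "K = {x :: 'a. ln (1 + x \<bullet> x) \<le> S - e}"
      have "K \<subseteq> B" using e by (auto simp: K_def B_def)
      moreover have "closed K"
        unfolding K_def by (intro closed_Collect_le continuous_intros continuous_on_ln_one_plus_inner)
      moreover have "bounded K"
        using bounded_subset[OF \<open>bounded B\<close> \<open>K \<subseteq> B\<close>] .
      moreover have "M \<le> V x" if "x \<in> B - K" for x
      proof -
        have "M' = A * e powr (- \<gamma>)" by (simp add: eM)
        also have "\<dots> \<le> V x"
          unfolding V_def using that A \<gamma> e
          by (intro mult_left_mono powr_mono2') (auto simp: K_def B_def)
        finally show ?thesis by (simp add: M'_def)
      qed
      ultimately show ?thesis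
        by (auto simp: compact_eq_bounded_closed)
    qed
    show "f x \<le> V x" if "x \<in> B" for x
      using f[rule_format, of x] that A by (simp add: log_barrier_def B_def V_def)
  qed (use assms that t in auto)
  show "ennreal (u x t) \<le> log_barrier A \<gamma> S x"
    using u_le by (auto simp: log_barrier_def B_def V_def intro!: ennreal_leI)
qed

text \<open>For fixed \<open>x\<close> the barrier is of order \<open>S powr (\<gamma> / 2) * S powr (- \<gamma>)\<close> as \<open>S\<close> grows.\<close>

lemma log_barrier_small:
  assumes "compact (K :: 'a::euclidean_space set)" "0 < e" "0 < \<gamma>"
  shows "\<exists>n. \<forall>x\<in>K. log_barrier (log_barrier_const DIM('a) \<gamma> (real (Suc n))) \<gamma> (real (Suc n)) x \<le> ennreal e"
proof -
  define d where "d = real DIM('a)"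
  have "0 < d" by (simp add: d_def)
  obtain R where R: "\<And>x. x \<in> K \<Longrightarrow> norm x \<le> R"
    using compact_imp_bounded[OF assms(1)] by (auto simp: bounded_iff)
  define c where "c = ln (1 + R\<^sup>2)"
  have c: "ln (1 + x \<bullet> x) \<le> c" if "x \<in> K" for x
  proof -
    have "(norm x)\<^sup>2 \<le> R\<^sup>2"
      using R[OF that] by (intro power_mono) auto
    then show ?thesis
      unfolding c_def power2_norm_eq_inner[symmetric] by (subst ln_le_cancel_iff) (auto intro: add_pos_nonneg)
  qed
  have "(\<lambda>n. (\<gamma> * (8 * (\<gamma> + 1) + 4 * d * real (Suc n))) powr (\<gamma> / 2) * (real (Suc n) - c) powr (- \<gamma>)) \<longlonglongrightarrow> 0"
    using \<open>0 < d\<close> \<open>0 < \<gamma>\<close> by real_asymp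
  then have "\<forall>\<^sub>F n in sequentially. log_barrier_const d \<gamma> (real (Suc n)) * (real (Suc n) - c) powr (- \<gamma>) < e"
    unfolding log_barrier_const_def using assms(2) by (rule order_tendstoD)
  moreover have "\<forall>\<^sub>F n in sequentially. c < real (Suc n)"
    by real_asymp
  ultimately obtain n where n: "log_barrier_const d \<gamma> (real (Suc n)) * (real (Suc n) - c) powr (- \<gamma>) < e"
    and nc: "c < real (Suc n)"
    using eventually_happens'[OF sequentially_bot eventually_conj] by blast
  have "log_barrier (log_barrier_const d \<gamma> (real (Suc n))) \<gamma> (real (Suc n)) x \<le> ennreal e" if "x \<in> K" for x
  proof -
    have "log_barrier_const d \<gamma> (real (Suc n)) * (real (Suc n) - ln (1 + x \<bullet> x)) powr (- \<gamma>)
        \<le> log_barrier_const d \<gamma> (real (Suc n)) * (real (Suc n) - c) powr (- \<gamma>)"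
      using c[OF that] nc assms(3)
      by (intro mult_left_mono powr_mono2') (auto simp: log_barrier_const_def)
    then show ?thesis
      using c[OF that] nc n by (auto simp: log_barrier_def intro!: ennreal_leI)
  qed
  then show ?thesis
    unfolding d_def by blast
qed

lemma compact_support_weighted_laplacian:
  assumes "1 < p"
    and "measure_valued_diffusion (weighted_laplacian m) (\<lambda>x. 0) (\<lambda>x. (1 + norm x) powr (m - 2)) p \<Omega> P X"
  shows "compact_support_property P (X :: real \<Rightarrow> 'w \<Rightarrow> 'a::euclidean_space measure)"
proof -
  interpret measure_valued_diffusion "weighted_laplacian m" "\<lambda>x :: 'a. 0"
    "\<lambda>x. (1 + norm x) powr (m - 2)" p \<Omega> P X
    by (rule assms(2))
  define \<gamma> where "\<gamma> = 2 / (p - 1)"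
  have "0 < \<gamma>" using assms(1) by (simp add: \<gamma>_def)
  define A where "A n = log_barrier_const DIM('a) \<gamma> (real (Suc n))" for n
  have A: "0 < A n" for n
  proof -
    have "0 < \<gamma> * (8 * (\<gamma> + 1) + 4 * real DIM('a) * real (Suc n))"
      using \<open>0 < \<gamma>\<close> by (intro mult_pos_pos add_pos_nonneg) auto
    then show ?thesis
      unfolding A_def log_barrier_const_def powr_gt_zero by (rule less_imp_neq[THEN not_sym])
  qed
  show ?thesis
  proof (rule compact_support_from_barriers)
    show "barrier (weighted_laplacian m) (\<lambda>x :: 'a. 0) (\<lambda>x. (1 + norm x) powr (m - 2)) p
        (log_barrier (A n) \<gamma> (real (Suc n)))" for n
      unfolding A_def \<gamma>_def using assms(1) by (intro barrier_log_barrier) auto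
    show "\<exists>n. \<forall>x\<in>K. log_barrier (A n) \<gamma> (real (Suc n)) x \<le> ennreal e" if "compact K" "0 < e" for K :: "'a set" and e
      unfolding A_def using that \<open>0 < \<gamma>\<close> by (rule log_barrier_small)
  qed (use A \<open>0 < \<gamma>\<close> in \<open>auto intro: approximable_log_barrier bounded_log_barrier simp: infinity_ennreal_def[symmetric] simp del: infinity_ennreal_def\<close>)
qed

section \<open>A bounded Lyapunov function\<close>

lemma C2_fun_radial:
  fixes g g' g'' :: "real \<Rightarrow> real"
  assumes I: "open I" "{0..} \<subseteq> I"
    and g: "\<And>\<rho>. \<rho> \<in> I \<Longrightarrow> (g has_real_derivative g' \<rho>) (at \<rho>)"
    and g': "\<And>\<rho>. \<rho> \<in> I \<Longrightarrow> (g' has_real_derivative g'' \<rho>) (at \<rho>)"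
    and g'': "continuous_on I g''"
  shows "C2_fun (\<lambda>x :: 'a::euclidean_space. g (x \<bullet> x))"
proof -
  have x_I: "x \<bullet> x \<in> I" for x :: 'a
    using I(2) by (auto simp: subset_eq)
  have "continuous_on I g'"
    using g' by (intro continuous_at_imp_continuous_on ballI DERIV_isCont)
  then have g'_cont: "continuous_on UNIV (\<lambda>x :: 'a. g' (x \<bullet> x))"
    by (rule continuous_on_compose2) (auto intro!: continuous_intros simp: x_I)
  have g''_cont: "continuous_on UNIV (\<lambda>x :: 'a. g'' (x \<bullet> x))"
    using g'' by (rule continuous_on_compose2) (auto intro!: continuous_intros simp: x_I)
  have *: "partial b (\<lambda>x. g (x \<bullet> x)) = (\<lambda>x :: 'a. 2 * g' (x \<bullet> x) * (x \<bullet> b))" for b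
    using partial_radial(2)[OF g[OF x_I]] by (auto simp: fun_eq_iff)
  show ?thesis
    unfolding C2_fun_def C1_fun_def
  proof (intro conjI allI ballI)
    show "(\<lambda>x. g (x \<bullet> x)) differentiable (at x)" for x :: 'a
      using partial_radial(1)[OF g[OF x_I]] unfolding differentiable_def by blast
    show "partial b (\<lambda>x. g (x \<bullet> x)) differentiable (at x)" for b x :: 'a
      by (rule partial_partial_radial(1)[OF I(1) x_I g g'])
    show "continuous_on UNIV (partial b (\<lambda>x. g (x \<bullet> x)))" for b :: 'a
      unfolding * by (intro continuous_intros g'_cont)
    show "continuous_on UNIV (partial c (partial b (\<lambda>x. g (x \<bullet> x))))" for b c :: 'a
    proof -
      have "partial c (partial b (\<lambda>x. g (x \<bullet> x)))
          = (\<lambda>x. 2 * g' (x \<bullet> x) * (c \<bullet> b) + 4 * g'' (x \<bullet> x) * (x \<bullet> b) * (x \<bullet> c))"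
        using partial_partial_radial(2)[OF I(1) x_I g g'] by (intro ext)
      then show ?thesis
        by (auto intro!: continuous_intros g'_cont g''_cont)
    qed
  qed
qed

lemma continuous_on_weighted_laplacian:
  fixes f :: "'a::euclidean_space \<Rightarrow> real"
  assumes "C2_fun f"
  shows "continuous_on UNIV (weighted_laplacian m f)"
proof -
  have "continuous_on UNIV (laplacian f)"
    unfolding laplacian_def using assms by (intro continuous_on_sum) (auto simp: C2_fun_def C1_fun_def)
  moreover have "1 + norm x \<noteq> 0" for x :: 'a
    using norm_ge_zero[of x] by linarith
  ultimately show ?thesis
    unfolding weighted_laplacian_def by (intro continuous_intros) auto
qed

text \<open>The function is \<open>(1 + |x|\<^sup>2) powr (- e)\<close> with small \<open>e > 0\<close>. In dimension at least three it is
  superharmonic, with \<open>\<Delta>f \<le> - e * (1 + |x|\<^sup>2) powr (- e - 1)\<close>, and for \<open>m > 2\<close> the weight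
  \<open>(1 + |x|) powr m\<close> makes up for this decay as soon as \<open>e \<le> m / 2 - 1\<close>.\<close>

lemma ex_bounded_lyapunov:
  assumes "2 < m" "3 \<le> DIM('a::euclidean_space)"
  shows "\<exists>f e. C2_fun f \<and> 0 < e \<and> (\<forall>x :: 'a. 0 \<le> f x \<and> f x \<le> 1 \<and> weighted_laplacian m f x \<le> - e)"
proof -
  \<comment> \<open>The first bound keeps \<open>4 * (e + 1)\<close> at most \<open>5\<close>, which \<open>2 * DIM('a) \<ge> 6\<close> beats by one.\<close>
  define e where "e = min (1 / 4) (m / 2 - 1)"
  have e: "0 < e" "e \<le> 1 / 4" "e \<le> m / 2 - 1"
    using assms(1) by (auto simp: e_def min_def)
  define g where "g \<rho> = (1 + \<rho>) powr (- e)" for \<rho>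
  define g' where "g' \<rho> = - e * (1 + \<rho>) powr (- e - 1)" for \<rho>
  define g'' where "g'' \<rho> = e * (e + 1) * (1 + \<rho>) powr (- e - 2)" for \<rho>
  define I where "I = {-1::real<..}"
  have dpow: "((\<lambda>\<rho>. (1 + \<rho>) powr a) has_real_derivative a * (1 + \<rho>) powr (a - 1)) (at \<rho>)"
    if "\<rho> \<in> I" for \<rho> a
    using that by (auto intro!: derivative_eq_intros simp: I_def powr_diff)
  have dg: "(g has_real_derivative g' \<rho>) (at \<rho>)" if "\<rho> \<in> I" for \<rho>
    unfolding g_def g'_def using dpow[OF that] .
  have dg': "(g' has_real_derivative g'' \<rho>) (at \<rho>)" if "\<rho> \<in> I" for \<rho>
    unfolding g'_def g''_def
    by (rule DERIV_cong[OF DERIV_cmult[OF dpow[OF that]]]) (simp add: algebra_simps)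
  have I: "open I" "{0..} \<subseteq> I" by (auto simp: I_def)
  have cg'': "continuous_on I g''"
    unfolding g''_def by (intro continuous_intros) (auto simp: I_def)
  have "C2_fun (\<lambda>x :: 'a. g (x \<bullet> x))"
    by (rule C2_fun_radial[OF I dg dg' cg''])
  moreover have "0 \<le> g (x \<bullet> x)" "g (x \<bullet> x) \<le> 1" for x :: 'a
  proof -
    show "0 \<le> g (x \<bullet> x)" by (simp add: g_def)
    have "(1 + x \<bullet> x) powr (- e) \<le> 1 powr (- e)"
      using e by (intro powr_mono2') auto
    then show "g (x \<bullet> x) \<le> 1" by (simp add: g_def)
  qed
  moreover have "weighted_laplacian m (\<lambda>x. g (x \<bullet> x)) x \<le> - e" for x :: 'a
  proof -
    define \<rho> where "\<rho> = x \<bullet> x"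
    have \<rho>: "0 \<le> \<rho>" by (simp add: \<rho>_def)
    define q where "q = (1 + \<rho>) powr (- e - 2)"
    have q: "0 \<le> q" by (simp add: q_def)
    have q1: "(1 + \<rho>) powr (- e - 1) = q * (1 + \<rho>)"
    proof -
      have "q * (1 + \<rho>) = (1 + \<rho>) powr (- e - 2) * (1 + \<rho>) powr 1"
        using \<rho> by (simp add: q_def)
      also have "\<dots> = (1 + \<rho>) powr ((- e - 2) + 1)"
        by (rule powr_add[symmetric])
      also have "(- e - 2) + 1 = - e - 1" by simp
      finally show ?thesis ..
    qed
    have "laplacian (\<lambda>x. g (x \<bullet> x)) x = 2 * DIM('a) * g' \<rho> + 4 * \<rho> * g'' \<rho>"
      unfolding \<rho>_def using I(2) by (intro laplacian_radial[OF I(1) _ dg dg']) (auto simp: subset_eq)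
    also have "\<dots> = e * q * (4 * (e + 1) * \<rho> - 2 * DIM('a) * (1 + \<rho>))"
      by (simp add: g'_def g''_def q1 q_def[symmetric] algebra_simps)
    also have "\<dots> \<le> e * q * (- (1 + \<rho>))"
    proof (intro mult_left_mono)
      have "4 * (e + 1) * \<rho> \<le> 5 * \<rho>"
        using e \<rho> by (intro mult_right_mono) auto
      moreover have "6 * (1 + \<rho>) \<le> 2 * DIM('a) * (1 + \<rho>)"
        using assms(2) \<rho> by (intro mult_right_mono) auto
      ultimately have "4 * (e + 1) * \<rho> - 2 * DIM('a) * (1 + \<rho>) \<le> 5 * \<rho> - 6 * (1 + \<rho>)"
        by (rule diff_mono)
      also have "\<dots> \<le> - (1 + \<rho>)" by simp
      finally show "4 * (e + 1) * \<rho> - 2 * DIM('a) * (1 + \<rho>) \<le> - (1 + \<rho>)" .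
    qed (use e q in auto)
    finally have lap: "laplacian (\<lambda>x. g (x \<bullet> x)) x \<le> - (e * (1 + \<rho>) powr (- e - 1))"
      by (simp add: q1 algebra_simps)
    have "1 \<le> (1 + \<rho>) powr (m / 2 - e - 1)"
      using e \<rho> by (intro ge_one_powr_ge_zero) auto
    also have "\<dots> = (1 + \<rho>) powr (m / 2) * (1 + \<rho>) powr (- e - 1)"
      unfolding powr_add[symmetric] by (simp add: algebra_simps)
    also have "(1 + \<rho>) powr (m / 2) \<le> (1 + norm x) powr m"
    proof -
      have "1 + \<rho> \<le> (1 + norm x)\<^sup>2"
        by (simp add: \<rho>_def power2_eq_square algebra_simps flip: power2_norm_eq_inner)
      then have "(1 + \<rho>) powr (m / 2) \<le> ((1 + norm x)\<^sup>2) powr (m / 2)"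
        using \<rho> assms(1) by (intro powr_mono2) auto
      also have "\<dots> = (1 + norm x) powr (2 * (m / 2))"
        using powr_powr[of "1 + norm x" 2 "m / 2"] by (simp add: add_nonneg_pos)
      finally show ?thesis by simp
    qed
    finally have "1 \<le> (1 + norm x) powr m * (1 + \<rho>) powr (- e - 1)"
      by (simp add: mult_right_mono)
    then have "e * 1 \<le> e * ((1 + norm x) powr m * (1 + \<rho>) powr (- e - 1))"
      using e by (intro mult_left_mono) auto
    moreover have "weighted_laplacian m (\<lambda>x. g (x \<bullet> x)) x
        \<le> (1 + norm x) powr m * - (e * (1 + \<rho>) powr (- e - 1))"
      unfolding weighted_laplacian_def by (intro mult_left_mono lap) auto
    ultimately show ?thesis
      by (simp add: algebra_simps)
  qed
  ultimately show ?thesis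
    using e(1) by blast
qed

section \<open>Exit times and the expected lifetime\<close>

definition beyond :: "real \<Rightarrow> 'a::real_normed_vector option set" where
  "beyond R = insert None (Some ` {y. R < norm y})"

lemma openin_beyond:
  "openin (Alexandroff_compactification euclidean) (beyond R :: 'a::euclidean_space option set)"
proof -
  have eq: "{y :: 'a. R < norm y} = topspace euclidean - cball 0 R" by auto
  show ?thesis
    unfolding openin_Alexandroff_compactification beyond_def eq
    by (intro disjI2 exI[of _ "cball 0 R"] conjI) simp_all
qed

lemma beyond_in_sets: "beyond R \<in> sets (compactified_borel :: 'a::euclidean_space option measure)"
  unfolding compactified_borel_def using openin_beyond by (auto simp: sets_measure_of intro: sigma_sets.Basic)

lemma beyond_iff: "y \<in> beyond R \<longleftrightarrow> (case y of None \<Rightarrow> True | Some y \<Rightarrow> R < norm y)"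
  by (cases y) (auto simp: beyond_def)

lemma exit_time_le:
  assumes "0 \<le> t" "case Y t \<omega> of None \<Rightarrow> True | Some y \<Rightarrow> real n \<le> norm y"
  shows "exit_time Y n \<omega> \<le> ennreal t"
  unfolding exit_time_def using assms by (intro Inf_lower) blast

lemma before_exit_time:
  assumes "0 \<le> t" "ennreal t < exit_time Y n \<omega>"
  shows "\<exists>y. Y t \<omega> = Some y \<and> norm y < real n"
  using exit_time_le[OF assms(1), where Y = Y and \<omega> = \<omega> and n = n] assms(2) by (cases "Y t \<omega>") (auto simp: not_le[symmetric])

lemma incseq_exit_time: "incseq (\<lambda>n. exit_time Y n \<omega>)"
proof (rule incseq_SucI)
  show "exit_time Y n \<omega> \<le> exit_time Y (Suc n) \<omega>" for n
    unfolding exit_time_def by (intro Inf_superset_mono) (fastforce split: option.splits)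
qed

lemma exit_time_tendsto_lifetime: "(\<lambda>n. exit_time Y n \<omega>) \<longlonglongrightarrow> lifetime Y \<omega>"
  using LIMSEQ_SUP[OF incseq_exit_time[of Y \<omega>]] by (auto simp: lifetime_def limI)

text \<open>A measurable substitute for \<open>exit_time\<close>, whose infimum ranges over uncountably many times. Asking
  for a norm strictly beyond \<open>n\<close> makes the target set open, so that rational times detect it along
  continuous paths; the price is a shift of \<open>n\<close> by one, which does not change the limit.\<close>

definition rational_exit_time :: "(real \<Rightarrow> 'w \<Rightarrow> 'a::euclidean_space option) \<Rightarrow> nat \<Rightarrow> 'w \<Rightarrow> ennreal" where
  "rational_exit_time Y n \<omega> =
     (INF q\<in>\<rat> \<inter> {0..}. if Y q \<omega> \<in> beyond (real n) then ennreal q else \<infinity>)"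

lemma exit_time_le_rational: "exit_time Y n \<omega> \<le> rational_exit_time Y n \<omega>"
  unfolding rational_exit_time_def
  by (rule INF_greatest) (auto intro!: exit_time_le simp: beyond_iff split: option.splits)

lemma incseq_rational_exit_time: "incseq (\<lambda>n. rational_exit_time Y n \<omega>)"
proof (rule incseq_SucI)
  show "rational_exit_time Y n \<omega> \<le> rational_exit_time Y (Suc n) \<omega>" for n
    unfolding rational_exit_time_def
    by (intro INF_mono) (fastforce simp: beyond_iff split: option.splits)
qed

context diffusion_process
begin

lemma space_P: "space (P x) = space \<Omega>"
  by (intro sets_eq_imp_space_eq sets_P)

lemma path_open_preimage:
  assumes "\<omega> \<in> space \<Omega>" "openin (Alexandroff_compactification euclidean) U"
  obtains A where "open A" "\<And>s. 0 \<le> s \<Longrightarrow> s \<in> A \<longleftrightarrow> Y s \<omega> \<in> U"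
proof -
  have "openin (top_of_set {0..}) {s \<in> {0..}. Y s \<omega> \<in> U}"
    using openin_continuous_map_preimage[OF continuous_paths[OF assms(1)] assms(2)] by simp
  then obtain A where "open A" "{s \<in> {0..}. Y s \<omega> \<in> U} = {0..} \<inter> A"
    by (auto simp: openin_open)
  then show thesis
    by (intro that[of A]) auto
qed

lemma rational_exit_time_le:
  assumes \<omega>: "\<omega> \<in> space \<Omega>"
  shows "rational_exit_time Y n \<omega> \<le> exit_time Y (Suc n) \<omega>"
  unfolding exit_time_def
proof (rule Inf_greatest)
  fix z
  assume "z \<in> {ennreal t |t. 0 \<le> t \<and> (case Y t \<omega> of None \<Rightarrow> True | Some y \<Rightarrow> real (Suc n) \<le> norm y)}"
  then obtain t where z: "z = ennreal t" and t: "0 \<le> t"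
    and exit: "case Y t \<omega> of None \<Rightarrow> True | Some y \<Rightarrow> real (Suc n) \<le> norm y"
    by blast
  obtain A where A: "open A" "\<And>s. 0 \<le> s \<Longrightarrow> s \<in> A \<longleftrightarrow> Y s \<omega> \<in> beyond (real n)"
    using path_open_preimage[OF \<omega> openin_beyond] by blast
  have "t \<in> A"
    using A(2)[OF t] exit by (auto simp: beyond_iff split: option.splits)
  then obtain d where "0 < d" and d: "ball t d \<subseteq> A"
    using A(1) by (auto simp: open_contains_ball)
  show "rational_exit_time Y n \<omega> \<le> z"
  proof (rule ccontr)
    assume "\<not> rational_exit_time Y n \<omega> \<le> z"
    then obtain c where c: "ennreal t < c" "c < rational_exit_time Y n \<omega>"
      using dense by (auto simp: not_le z)
    then obtain b where b: "c = ennreal b" "0 \<le> b"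
      by (cases c) auto
    then have "t < b"
      using c(1) t by (simp add: ennreal_less_iff)
    then have "t < min b (t + d)"
      using \<open>0 < d\<close> by simp
    then obtain q where q: "q \<in> \<rat>" "t < q" "q < min b (t + d)"
      using Rats_dense_in_real by blast
    then have "q \<in> A" "0 \<le> q"
      using d t by (auto simp: subset_eq dist_real_def)
    then have "rational_exit_time Y n \<omega> \<le> ennreal q"
      unfolding rational_exit_time_def using A(2) q(1) by (intro INF_lower2[of q]) auto
    also have "\<dots> \<le> c"
      using q(3) b by (auto intro!: ennreal_leI)
    finally show False using c(2) by simp
  qed
qed

lemma measurable_rational_exit_time: "rational_exit_time Y n \<in> borel_measurable (P x)"
  unfolding rational_exit_time_def
proof (rule borel_measurable_INF)
  show "countable (\<rat> \<inter> {0::real..})" by (simp add: countable_rat)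
  fix q :: real assume "q \<in> \<rat> \<inter> {0..}"
  then have "Y q \<in> measurable (P x) compactified_borel"
    using measurable_Y[of q] sets_P[of x] by (simp cong: measurable_cong_sets)
  then have "Measurable.pred (P x) (\<lambda>\<omega>. Y q \<omega> \<in> beyond (real n))"
    using beyond_in_sets by measurable
  then show "(\<lambda>\<omega>. if Y q \<omega> \<in> beyond (real n) then ennreal q else \<infinity>) \<in> borel_measurable (P x)"
    by measurable
qed

lemma lifetime_eq_SUP:
  assumes "\<omega> \<in> space \<Omega>"
  shows "lifetime Y \<omega> = (SUP n. min (of_nat n) (rational_exit_time Y n \<omega>))"
proof -
  have "(\<lambda>n. rational_exit_time Y n \<omega>) \<longlonglongrightarrow> lifetime Y \<omega>"
    by (rule tendsto_sandwich[OF _ _ exit_time_tendsto_lifetime LIMSEQ_Suc[OF exit_time_tendsto_lifetime]])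
      (auto intro!: always_eventually exit_time_le_rational rational_exit_time_le assms)
  then have "(\<lambda>n. min (of_nat n) (rational_exit_time Y n \<omega>)) \<longlonglongrightarrow> min \<top> (lifetime Y \<omega>)"
    by (intro tendsto_min of_nat_tendsto_top_ennreal)
  moreover have "(\<lambda>n. min (of_nat n) (rational_exit_time Y n \<omega>))
      \<longlonglongrightarrow> (SUP n. min (of_nat n) (rational_exit_time Y n \<omega>))"
    using incseq_rational_exit_time[of Y \<omega>]
    by (intro LIMSEQ_SUP incseq_SucI min.mono) (auto simp: incseq_Suc_iff)
  ultimately show ?thesis
    using LIMSEQ_unique by fastforce
qed

text \<open>Before the exit time the path stays in a ball. At the exit time it cannot be in the cemetery
  state: this state together with the complement of a closed ball is an open set, which the path
  would have entered at an earlier time.\<close>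

lemma continuous_before_exit:
  assumes \<omega>: "\<omega> \<in> space \<Omega>" and start: "Y 0 \<omega> = Some x"
    and r: "0 \<le> r" "ennreal r \<le> exit_time Y n \<omega>"
  shows "continuous_on {0..r} (\<lambda>s. the (Y s \<omega>))"
proof -
  have before: "\<exists>y. Y s \<omega> = Some y \<and> norm y < real n" if "0 \<le> s" "s < r" for s
  proof -
    have "ennreal s < ennreal r" using that by (simp add: ennreal_less_iff)
    then have "ennreal s < exit_time Y n \<omega>" using r(2) by (rule less_le_trans)
    with that(1) show ?thesis by (rule before_exit_time)
  qed
  have "Y r \<omega> \<noteq> None"
  proof
    assume None: "Y r \<omega> = None"
    then have "0 < r" using start r by (cases "r = 0") auto
    obtain A where A: "open A" "\<And>s. 0 \<le> s \<Longrightarrow> s \<in> A \<longleftrightarrow> Y s \<omega> \<in> beyond (real n)"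
      using path_open_preimage[OF \<omega> openin_beyond] by blast
    have "r \<in> A" using A(2)[OF r(1)] None by (simp add: beyond_iff)
    then obtain d where "0 < d" "ball r d \<subseteq> A"
      using A(1) by (auto simp: open_contains_ball)
    define s where "s = max 0 (r - d / 2)"
    have s: "0 \<le> s" "s < r" "s \<in> A"
      using \<open>0 < r\<close> \<open>0 < d\<close> \<open>ball r d \<subseteq> A\<close> by (auto simp: s_def subset_eq dist_real_def)
    then show False
      using A(2)[of s] before[of s] by (auto simp: beyond_iff)
  qed
  then have alive: "Y s \<omega> = Some (the (Y s \<omega>))" if "s \<in> {0..r}" for s
    using before[of s] that by (cases "s = r") auto
  show ?thesis
    unfolding continuous_on_open_invariant
  proof (intro allI impI)
    fix B :: "'a set" assume "open B"
    then have "openin (Alexandroff_compactification euclidean) (Some ` B)" by simp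
    from path_open_preimage[OF \<omega> this] obtain A
      where "open A" and A: "\<And>s. 0 \<le> s \<Longrightarrow> s \<in> A \<longleftrightarrow> Y s \<omega> \<in> Some ` B" by blast
    have "s \<in> A \<longleftrightarrow> the (Y s \<omega>) \<in> B" if "s \<in> {0..r}" for s
      using A[of s] alive[OF that] that by (metis atLeastAtMost_iff image_iff option.sel)
    then show "\<exists>A. open A \<and> A \<inter> {0..r} = (\<lambda>s. the (Y s \<omega>)) -` B \<inter> {0..r}"
      using \<open>open A\<close> by (intro exI[of _ A]) auto
  qed
qed

text \<open>Continuity up to the exit time also guarantees that the time integral in the definition of the
  process is a genuine one and not the default value \<open>0\<close>.\<close>

lemma dynkin_process_ge:
  assumes f: "\<And>x. 0 \<le> f x" "continuous_on UNIV (L f)" "\<And>x. L f x \<le> - e"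
    and \<omega>: "\<omega> \<in> space \<Omega>" "Y 0 \<omega> = Some x" and t: "0 \<le> t"
  shows "e * enn2real (min (ennreal t) (exit_time Y n \<omega>)) \<le> dynkin_process L Y n f t \<omega>"
proof -
  define r where "r = enn2real (min (ennreal t) (exit_time Y n \<omega>))"
  have "min (ennreal t) (exit_time Y n \<omega>) < \<top>"
    by (simp add: min_less_iff_disj)
  then have r: "0 \<le> r" "ennreal r \<le> exit_time Y n \<omega>"
    by (simp_all add: r_def)
  have cont: "continuous_on {0..r} (\<lambda>s. L f (the (Y s \<omega>)))"
    by (rule continuous_on_compose2[OF f(2) continuous_before_exit[OF \<omega> r]]) auto
  have "integral {0..r} (\<lambda>s. L f (the (Y s \<omega>))) \<le> integral {0..r} (\<lambda>s. - e)"
    by (intro integral_le integrable_continuous_real cont continuous_intros f(3))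
  also have "\<dots> = - (e * r)"
    using r by simp
  finally have "e * r \<le> f (the (Y r \<omega>)) - integral {0..r} (\<lambda>s. L f (the (Y s \<omega>)))"
    using f(1)[of "the (Y r \<omega>)"] by simp
  then show ?thesis
    by (simp add: dynkin_process_def r_def[symmetric] Let_def)
qed

lemma expected_dynkin_process:
  assumes "C2_fun f" and t: "0 \<le> t"
  shows "integrable (P x) (dynkin_process L Y n f t)"
    and "(\<integral>\<omega>. dynkin_process L Y n f t \<omega> \<partial>P x) = f x"
proof -
  interpret prob_space "P x" by (rule prob_space_P)
  let ?F = "natural_filtration \<Omega> compactified_borel Y 0"
  let ?M = "dynkin_process L Y n f"
  have M: "integrable (P x) (?M t)"
    "AE \<omega> in P x. real_cond_exp (P x) ?F (?M t) \<omega> = ?M 0 \<omega>"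
    "?M 0 \<in> borel_measurable (P x)"
    using martingale_problem[OF assms(1), of x n] t
    by (auto simp: martingale_def dest: borel_measurable_integrable)
  show "integrable (P x) (?M t)" by (rule M)
  interpret finite_measure_subalgebra "P x" ?F
    by unfold_locales (rule natural_filtration_subalgebra[OF measurable_Y sets_P order_refl])
  have "(\<integral>\<omega>. ?M t \<omega> \<partial>P x) = (\<integral>\<omega>. real_cond_exp (P x) ?F (?M t) \<omega> \<partial>P x)"
    using real_cond_exp_int(2)[OF M(1)] by simp
  also have "\<dots> = (\<integral>\<omega>. ?M 0 \<omega> \<partial>P x)"
    using M by (intro integral_cong_AE) auto
  also have "\<dots> = (\<integral>\<omega>. f x \<partial>P x)"
  proof (rule integral_cong_AE)
    show "AE \<omega> in P x. ?M 0 \<omega> = f x"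
      using starts_at[of x] by eventually_elim (simp add: dynkin_process_def)
  qed (use M in auto)
  finally show "(\<integral>\<omega>. ?M t \<omega> \<partial>P x) = f x"
    by (simp add: prob_space)
qed

text \<open>Dynkin's formula: \<open>f x\<close> equals the expectation of the Dynkin process, which is at least \<open>e\<close> times
  the stopped time.\<close>

lemma expected_exit_time_le:
  assumes f: "C2_fun f" "\<And>x. 0 \<le> f x" "continuous_on UNIV (L f)" "\<And>x. L f x \<le> - e"
    and e: "0 < e" and t: "0 \<le> t"
  shows "(\<integral>\<^sup>+ \<omega>. min (ennreal t) (exit_time Y n \<omega>) \<partial>P x) \<le> ennreal (f x / e)"
proof -
  let ?M = "dynkin_process L Y n f"
  have ge: "AE \<omega> in P x. e * enn2real (min (ennreal t) (exit_time Y n \<omega>)) \<le> ?M t \<omega>"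
    using starts_at[of x] AE_space[of "P x"]
    by eventually_elim (auto intro!: dynkin_process_ge f t simp: space_P)
  have "(\<integral>\<^sup>+ \<omega>. min (ennreal t) (exit_time Y n \<omega>) \<partial>P x) \<le> (\<integral>\<^sup>+ \<omega>. ennreal (?M t \<omega> / e) \<partial>P x)"
  proof (rule nn_integral_mono_AE)
    show "AE \<omega> in P x. min (ennreal t) (exit_time Y n \<omega>) \<le> ennreal (?M t \<omega> / e)"
      using ge
    proof eventually_elim
      case (elim \<omega>)
      have "min (ennreal t) (exit_time Y n \<omega>) < \<top>"
        by (simp add: min_less_iff_disj)
      then have "min (ennreal t) (exit_time Y n \<omega>)
          = ennreal (enn2real (min (ennreal t) (exit_time Y n \<omega>)))" by simp
      also have "\<dots> \<le> ennreal (?M t \<omega> / e)"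
        using elim e by (intro ennreal_leI) (simp add: field_simps)
      finally show ?case .
    qed
  qed
  also have "\<dots> = ennreal (\<integral>\<omega>. ?M t \<omega> / e \<partial>P x)"
  proof (rule nn_integral_eq_integral)
    show "AE \<omega> in P x. 0 \<le> ?M t \<omega> / e"
      using ge
    proof eventually_elim
      case (elim \<omega>)
      have "0 \<le> e * enn2real (min (ennreal t) (exit_time Y n \<omega>))" using e by simp
      then have "0 \<le> ?M t \<omega>" using elim by (rule order_trans)
      then show ?case using e by simp
    qed
  qed (use expected_dynkin_process(1)[OF f(1) t] in simp)
  also have "\<dots> = ennreal (f x / e)"
    by (simp add: expected_dynkin_process(2)[OF f(1) t])
  finally show ?thesis .
qed

lemma expected_lifetime_le:
  assumes f: "C2_fun f" "\<And>x. 0 \<le> f x" "continuous_on UNIV (L f)" "\<And>x. L f x \<le> - e"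
    and e: "0 < e"
  shows "(\<integral>\<^sup>+ \<omega>. lifetime Y \<omega> \<partial>P x) \<le> ennreal (f x / e)"
proof -
  have "(\<integral>\<^sup>+ \<omega>. lifetime Y \<omega> \<partial>P x) = (\<integral>\<^sup>+ \<omega>. (SUP n. min (of_nat n) (rational_exit_time Y n \<omega>)) \<partial>P x)"
    by (intro nn_integral_cong) (simp add: lifetime_eq_SUP space_P)
  also have "\<dots> = (SUP n. \<integral>\<^sup>+ \<omega>. min (of_nat n) (rational_exit_time Y n \<omega>) \<partial>P x)"
  proof (rule nn_integral_monotone_convergence_SUP)
    show "incseq (\<lambda>n \<omega>. min (of_nat n) (rational_exit_time Y n \<omega>))"
      using incseq_rational_exit_time[of Y]
      by (intro incseq_SucI le_funI min.mono) (auto simp: incseq_Suc_iff)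
  qed (use measurable_rational_exit_time in simp)
  also have "\<dots> \<le> ennreal (f x / e)"
  proof (rule SUP_least)
    fix n
    have "(\<integral>\<^sup>+ \<omega>. min (of_nat n) (rational_exit_time Y n \<omega>) \<partial>P x)
        \<le> (\<integral>\<^sup>+ \<omega>. min (ennreal (real n)) (exit_time Y (Suc n) \<omega>) \<partial>P x)"
      by (intro nn_integral_mono min.mono) (auto simp: rational_exit_time_le space_P ennreal_of_nat_eq_real_of_nat)
    also have "\<dots> \<le> ennreal (f x / e)"
      by (intro expected_exit_time_le f e) simp_all
    finally show "(\<integral>\<^sup>+ \<omega>. min (of_nat n) (rational_exit_time Y n \<omega>) \<partial>P x) \<le> ennreal (f x / e)" .
  qed
  finally show ?thesis .
qed

lemma explosive_if_bounded_lyapunov: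
  assumes f: "C2_fun f" "\<And>x. 0 \<le> f x" "\<And>x. f x \<le> 1" "continuous_on UNIV (L f)" "\<And>x. L f x \<le> - e"
    and e: "0 < e"
  shows "explosive P Y" and "(SUP x. \<integral>\<^sup>+ \<omega>. lifetime Y \<omega> \<partial>P x) < \<infinity>"
proof -
  have le: "(\<integral>\<^sup>+ \<omega>. lifetime Y \<omega> \<partial>P x) \<le> ennreal (1 / e)" for x
  proof -
    have "(\<integral>\<^sup>+ \<omega>. lifetime Y \<omega> \<partial>P x) \<le> ennreal (f x / e)"
      by (rule expected_lifetime_le[OF f(1,2,4,5) e])
    also have "\<dots> \<le> ennreal (1 / e)"
      using f(3)[of x] e by (intro ennreal_leI divide_right_mono) auto
    finally show ?thesis .
  qed
  then have "(SUP x. \<integral>\<^sup>+ \<omega>. lifetime Y \<omega> \<partial>P x) \<le> ennreal (1 / e)"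
    by (intro SUP_least)
  then show "(SUP x. \<integral>\<^sup>+ \<omega>. lifetime Y \<omega> \<partial>P x) < \<infinity>"
    using le_less_trans by fastforce
  show "explosive P Y"
  proof
    assume "nonexplosive P Y"
    then obtain x where "AE \<omega> in P x. \<not> lifetime Y \<omega> < \<infinity>"
      by (auto simp: nonexplosive_def)
    then have "AE \<omega> in P x. lifetime Y \<omega> = \<infinity>"
      by eventually_elim (simp add: not_less top_unique)
    then have "(\<integral>\<^sup>+ \<omega>. lifetime Y \<omega> \<partial>P x) = (\<integral>\<^sup>+ \<omega>. \<infinity> \<partial>P x)"
      by (rule nn_integral_cong_AE)
    also have "\<dots> = \<infinity>"
      using prob_space.emeasure_space_1[OF prob_space_P] by simp
    finally show False
      using le[of x] by (simp add: top_unique)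
  qed
qed

end

lemma explosive_weighted_laplacian:
  fixes Y :: "real \<Rightarrow> 'v \<Rightarrow> 'a::euclidean_space option"
  assumes "diffusion_process (weighted_laplacian m) \<Omega> P Y" "2 < m" "3 \<le> DIM('a)"
  shows "explosive P Y" and "(SUP x. \<integral>\<^sup>+ \<omega>. lifetime Y \<omega> \<partial>P x) < \<infinity>"
proof -
  interpret diffusion_process "weighted_laplacian m" \<Omega> P Y by (rule assms(1))
  obtain f :: "'a \<Rightarrow> real" and e where f: "C2_fun f" "0 < e"
    "\<And>x. 0 \<le> f x" "\<And>x. f x \<le> 1" "\<And>x. weighted_laplacian m f x \<le> - e"
    using ex_bounded_lyapunov[OF assms(2,3)] by blast
  note * = explosive_if_bounded_lyapunov[OF f(1,3,4) continuous_on_weighted_laplacian[OF f(1)] f(5,2)]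
  show "explosive P Y" by (rule *)
  show "(SUP x. \<integral>\<^sup>+ \<omega>. lifetime Y \<omega> \<partial>P x) < \<infinity>" by (rule *)
qed

section \<open>Compact support in spite of explosion\<close>

theorem proposition1:
  fixes m p :: real
    and \<Omega>\<^sub>X :: "'w measure" and P\<^sub>X :: "'a::euclidean_space measure \<Rightarrow> 'w measure"
    and X :: "real \<Rightarrow> 'w \<Rightarrow> 'a measure"
    and \<Omega>\<^sub>Y :: "'v measure" and P\<^sub>Y :: "'a \<Rightarrow> 'v measure"
    and Y :: "real \<Rightarrow> 'v \<Rightarrow> 'a option"
  assumes "1 < p" and "p \<le> 2"
  shows "(measure_valued_diffusion (weighted_laplacian m) (\<lambda>x. 0) (\<lambda>x. (1 + norm x) powr (m - 2)) p
            \<Omega>\<^sub>X P\<^sub>X X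
          \<longrightarrow> compact_support_property P\<^sub>X X) \<and>
         (diffusion_process (weighted_laplacian m) \<Omega>\<^sub>Y P\<^sub>Y Y \<and> m > 2 \<and> DIM('a) \<ge> 3
          \<longrightarrow> explosive P\<^sub>Y Y \<and> (SUP x. \<integral>\<^sup>+ \<omega>. lifetime Y \<omega> \<partial>P\<^sub>Y x) < \<infinity>)"
proof (intro conjI impI)
  assume "measure_valued_diffusion (weighted_laplacian m) (\<lambda>x :: 'a. 0) (\<lambda>x. (1 + norm x) powr (m - 2)) p
    \<Omega>\<^sub>X P\<^sub>X X"
  then show "compact_support_property P\<^sub>X X"
    using \<open>1 < p\<close> by (intro compact_support_weighted_laplacian)
next
  assume "diffusion_process (weighted_laplacian m) \<Omega>\<^sub>Y P\<^sub>Y Y \<and> m > 2 \<and> DIM('a) \<ge> 3"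
  then show "explosive P\<^sub>Y Y" "(SUP x. \<integral>\<^sup>+ \<omega>. lifetime Y \<omega> \<partial>P\<^sub>Y x) < \<infinity>"
    using explosive_weighted_laplacian by blast+
qed

end
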